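(* Let $M$ be an odd Poisson supermanifold, let $\boldsymbol{\rho}$ and $\boldsymbol{\rho}'=e^{\sigma}\boldsymbol{\rho}$ be non-degenerate volume forms on $M$ with $\sigma$ an even function, and let $\Delta$ and $\Delta'$ be the odd Laplace operators on half-densities corresponding to $\boldsymbol{\rho}$ and $\boldsymbol{\rho}'$ respectively, i.e. $\Delta(\boldsymbol{s})=\boldsymbol{\rho}^{1/2}\Delta_{\boldsymbol{\rho}}(\boldsymbol{s}\boldsymbol{\rho}^{-1/2})$ and $\Delta'(\boldsymbol{s})=\boldsymbol{\rho}'^{1/2}\Delta_{\boldsymbol{\rho}'}(\boldsymbol{s}\boldsymbol{\rho}'^{-1/2})$ for every half-density $\boldsymbol{s}$. Then $$\Delta'=\Delta-e^{-\sigma/2}\Delta_{\boldsymbol{\rho}}e^{\sigma/2}=\Delta-\tfrac12H(\boldsymbol{\rho}',\boldsymbol{\rho}),$$ where the function $e^{-\sigma/2}\Delta_{\boldsymbol{\rho}}e^{\sigma/2}:=e^{-\sigma/2}\cdot\Delta_{\boldsymbol{\rho}}(e^{\sigma/2})$ acts by multiplication and $H(\boldsymbol{\rho}',\boldsymbol{\rho})=\Delta_{\boldsymbol{\rho}}\sigma-\frac12\{\sigma,\sigma\}=2e^{-\sigma/2}\Delta_{\boldsymbol{\rho}}e^{\sigma/2}$.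
   Context: Setting. $M$ is a smooth supermanifold with local coordinates $x^a$ of parity $\tilde a$; tilde denotes parity; derivatives are left derivatives. An odd Poisson (Schouten) structure on $M$ is an odd function $\mathfrak{S}=\frac12\mathfrak{S}^{ab}(x)p_bp_a$ on $T^*M$, quadratic in the momenta, with $\mathfrak{S}^{ab}=(-1)^{\tilde a\tilde b}\mathfrak{S}^{ba}$ of parity $\tilde a+\tilde b+1$, satisfying $(\mathfrak{S},\mathfrak{S})=0$ for the canonical even Poisson bracket $(\ ,\ )$ on $T^*M$. The odd bracket is $\{f,g\}=(f,(\mathfrak{S},g))=-(-1)^{\tilde f(\tilde a+1)}\mathfrak{S}^{ab}\frac{\partial f}{\partial x^b}\frac{\partial g}{\partial x^a}$; the condition $(\mathfrak{S},\mathfrak{S})=0$ is equivalent to its graded Jacobi identity. A supermanifold with such a structure is an odd Poisson (= Schouten) manifold. Hamiltonian vector field: $X_f:=(-1)^{\tilde f+1}\{f,\ \}=(-1)^{\tilde a\tilde f}\mathfrak{S}^{ab}\frac{\partial f}{\partial x^b}\frac{\partial}{\partial x^a}$, of parity $\tilde f+1$. A volume form is locally $\boldsymbol{\rho}=\rho\,Dx$, where $Dx$ is the Berezin coordinate volume element (transforming by the Berezinian); non-degenerate means it is a basis element of the module of volume forms ($\rho$ even and invertible). Standing convention: $M$ is oriented and coefficients $\rho$ are positive, so that real powers make sense. The divergence is $\mathrm{div}_{\boldsymbol{\rho}}X=\frac1\rho(-1)^{\tilde a(\tilde X+1)}\frac{\partial(\rho X^a)}{\partial x^a}$. The odd Laplace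 operator on functions is $\Delta_{\boldsymbol{\rho}}f:=\mathrm{div}_{\boldsymbol{\rho}}X_f=\frac1\rho\frac{\partial}{\partial x^a}\left(\rho\,\mathfrak{S}^{ab}\frac{\partial f}{\partial x^b}\right)$. Half-densities are densities of weight $1/2$, locally $s(x)(Dx)^{1/2}$ (transforming by the square root of the Berezinian); given a non-degenerate $\boldsymbol{\rho}$, they all have the form $\boldsymbol{s}=s\boldsymbol{\rho}^{1/2}$ with $s$ a function, and $\boldsymbol{s}\boldsymbol{\rho}^{-1/2}=s$. *)

theory Defs
  imports "HOL-Analysis.Analysis"
begin

section \<open>Grassmann algebra\<close>

text \<open>
  The (completed) real Grassmann algebra on generators \<open>\<theta>\<^sub>0, \<theta>\<^sub>1, \<dots>\<close>.  The coefficient at a finite set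
  \<open>K = {k\<^sub>1 < \<dots> < k\<^sub>r}\<close> belongs to the monomial \<open>\<theta>\<^sub>K = \<theta>\<^bsub>k\<^sub>1\<^esub> \<cdots> \<theta>\<^bsub>k\<^sub>r\<^esub>\<close>.  The Grassmann algebra on \<open>q\<close>
  generators is the subalgebra of elements supported on subsets of \<open>{..<q}\<close>.  Using one type for all
  \<open>q\<close> keeps the odd dimension an ordinary number, with \<open>q = 0\<close> allowed.
\<close>

typedef grassmann = "{f :: nat set \<Rightarrow> real. \<forall>K. infinite K \<longrightarrow> f K = 0}"
  morphisms gcoef Abs_grassmann
  by (rule exI[of _ "\<lambda>_. 0"]) simp

setup_lifting type_definition_grassmann

lemma grassmann_eqI: "(\<And>K. finite K \<Longrightarrow> gcoef f K = gcoef g K) \<Longrightarrow> f = g"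
  by transfer (metis ext)

lemma gcoef_infinite: "infinite K \<Longrightarrow> gcoef f K = 0"
  by transfer simp

text \<open>\<open>\<theta>\<^sub>I \<theta>\<^sub>J = shuffle_sign I J \<theta>\<^bsub>I \<union> J\<^esub>\<close> for disjoint \<open>I\<close>, \<open>J\<close>.\<close>

definition shuffle_sign :: "nat set \<Rightarrow> nat set \<Rightarrow> real" where
  "shuffle_sign I J = (- 1) ^ card {(i, j). i \<in> I \<and> j \<in> J \<and> j < i}"

lemma finite_inversions: "finite I \<Longrightarrow> finite J \<Longrightarrow> finite {(i, j). i \<in> I \<and> j \<in> J \<and> j < (i::nat)}"
  by (rule finite_subset[of _ "I \<times> J"]) auto

lemma shuffle_sign_empty [simp]: "shuffle_sign {} J = 1" "shuffle_sign I {} = 1"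
  by (auto simp: shuffle_sign_def)

lemma shuffle_sign_Un_left:
  assumes "finite I" "finite M" "finite N" "I \<inter> M = {}"
  shows "shuffle_sign (I \<union> M) N = shuffle_sign I N * shuffle_sign M N"
proof -
  have "{(i, j). i \<in> I \<union> M \<and> j \<in> N \<and> j < i} =
    {(i, j). i \<in> I \<and> j \<in> N \<and> j < i} \<union> {(i, j). i \<in> M \<and> j \<in> N \<and> j < i}" by auto
  moreover have "card \<dots> = card {(i, j). i \<in> I \<and> j \<in> N \<and> j < i} + card {(i, j). i \<in> M \<and> j \<in> N \<and> j < i}"
    by (rule card_Un_disjoint) (use assms finite_inversions in auto)
  ultimately show ?thesis by (simp add: shuffle_sign_def power_add)
qed

lemma shuffle_sign_Un_right:
  assumes "finite I" "finite M" "finite N" "M \<inter> N = {}"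
  shows "shuffle_sign I (M \<union> N) = shuffle_sign I M * shuffle_sign I N"
proof -
  have "{(i, j). i \<in> I \<and> j \<in> M \<union> N \<and> j < i} =
    {(i, j). i \<in> I \<and> j \<in> M \<and> j < i} \<union> {(i, j). i \<in> I \<and> j \<in> N \<and> j < i}" by auto
  moreover have "card \<dots> = card {(i, j). i \<in> I \<and> j \<in> M \<and> j < i} + card {(i, j). i \<in> I \<and> j \<in> N \<and> j < i}"
    by (rule card_Un_disjoint) (use assms finite_inversions in auto)
  ultimately show ?thesis by (simp add: shuffle_sign_def power_add)
qed

instantiation grassmann :: real_algebra_1
begin

lift_definition zero_grassmann :: grassmann is "\<lambda>_. 0" by simp
lift_definition one_grassmann :: grassmann is "\<lambda>K. if K = {} then 1 else 0" by auto
lift_definition plus_grassmann :: "grassmann \<Rightarrow> grassmann \<Rightarrow> grassmann" is "\<lambda>f g K. f K + g K" by simp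
lift_definition minus_grassmann :: "grassmann \<Rightarrow> grassmann \<Rightarrow> grassmann" is "\<lambda>f g K. f K - g K" by simp
lift_definition uminus_grassmann :: "grassmann \<Rightarrow> grassmann" is "\<lambda>f K. - f K" by simp
lift_definition scaleR_grassmann :: "real \<Rightarrow> grassmann \<Rightarrow> grassmann" is "\<lambda>c f K. c * f K" by simp
lift_definition times_grassmann :: "grassmann \<Rightarrow> grassmann \<Rightarrow> grassmann" is
  "\<lambda>f g K. if finite K then \<Sum>I\<in>Pow K. shuffle_sign I (K - I) * f I * g (K - I) else 0" by simp

instance
proof
  fix f g h :: grassmann
  show "f * g * h = f * (g * h)"
  proof (rule grassmann_eqI)
    fix K :: "nat set" assume K: "finite K"
    have fin: "finite L" if "L \<subseteq> K" for L using K that finite_subset by blast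
    have "gcoef (f * g * h) K =
      (\<Sum>L\<in>Pow K. \<Sum>I\<in>Pow L. shuffle_sign L (K - L) * shuffle_sign I (L - I) *
          (gcoef f I * gcoef g (L - I) * gcoef h (K - L)))"
      using K fin by (auto simp: times_grassmann.rep_eq sum_distrib_left sum_distrib_right mult_ac intro!: sum.cong)
    also have "\<dots> = (\<Sum>(L, I)\<in>(SIGMA L:Pow K. Pow L). shuffle_sign L (K - L) * shuffle_sign I (L - I) *
          (gcoef f I * gcoef g (L - I) * gcoef h (K - L)))"
      by (subst sum.Sigma) (use K fin in auto)
    also have "\<dots> = (\<Sum>(I, M)\<in>(SIGMA I:Pow K. Pow (K - I)). shuffle_sign I (K - I) * shuffle_sign M (K - I - M) *
          (gcoef f I * gcoef g M * gcoef h (K - I - M)))"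
    proof (rule sum.reindex_bij_witness[where i = "\<lambda>(I, M). (I \<union> M, I)" and j = "\<lambda>(L, I). (I, L - I)"], goal_cases)
      case (5 a)
      then obtain L I where a: "a = (L, I)" and sub: "I \<subseteq> L" "L \<subseteq> K" by auto
      have eq: "K - I - (L - I) = K - L" "L = I \<union> (L - I)" "K - I = (L - I) \<union> (K - L)" using sub by auto
      have fins: "finite I" "finite (L - I)" "finite (K - L)" using fin sub by auto
      have "shuffle_sign L (K - L) = shuffle_sign I (K - L) * shuffle_sign (L - I) (K - L)"
        using shuffle_sign_Un_left[of I "L - I" "K - L"] fins eq(2) by (metis Diff_disjoint)
      moreover have "shuffle_sign I (K - I) = shuffle_sign I (L - I) * shuffle_sign I (K - L)"
        by (subst eq(3), rule shuffle_sign_Un_right) (use fins in auto)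
      ultimately show ?case by (simp add: a eq(1))
    qed auto
    also have "\<dots> = (\<Sum>I\<in>Pow K. \<Sum>M\<in>Pow (K - I). shuffle_sign I (K - I) * shuffle_sign M (K - I - M) *
          (gcoef f I * gcoef g M * gcoef h (K - I - M)))"
      by (subst sum.Sigma) (use K fin in auto)
    also have "\<dots> = gcoef (f * (g * h)) K"
      using K fin by (auto simp: times_grassmann.rep_eq sum_distrib_left sum_distrib_right mult_ac intro!: sum.cong)
    finally show "gcoef (f * g * h) K = gcoef (f * (g * h)) K" .
  qed
  show "1 * f = f"
  proof (rule grassmann_eqI)
    fix K :: "nat set" assume K: "finite K"
    have "gcoef (1 * f) K = (\<Sum>I\<in>Pow K. if I = {} then gcoef f K else 0)"
      unfolding times_grassmann.rep_eq one_grassmann.rep_eq if_P[OF K] by (rule sum.cong) auto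
    then show "gcoef (1 * f) K = gcoef f K" using K by simp
  qed
  show "f * 1 = f"
  proof (rule grassmann_eqI)
    fix K :: "nat set" assume K: "finite K"
    have "gcoef (f * 1) K = (\<Sum>I\<in>Pow K. if I = K then gcoef f K else 0)"
      unfolding times_grassmann.rep_eq one_grassmann.rep_eq if_P[OF K] by (rule sum.cong) auto
    then show "gcoef (f * 1) K = gcoef f K" using K by simp
  qed
  show "(f + g) * h = f * h + g * h" "f * (g + h) = f * g + f * h"
    by (rule grassmann_eqI; simp add: times_grassmann.rep_eq plus_grassmann.rep_eq
        algebra_simps sum.distrib)+
  show "(0::grassmann) \<noteq> 1"
    by transfer (metis zero_neq_one)
  fix a b :: real
  show "a *\<^sub>R f * g = a *\<^sub>R (f * g)" "f * a *\<^sub>R g = a *\<^sub>R (f * g)"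
    by (rule grassmann_eqI; simp add: times_grassmann.rep_eq scaleR_grassmann.rep_eq
        sum_distrib_left mult_ac)+
  show "f + g + h = f + (g + h)" "f + g = g + f" "0 + f = f" "- f + f = 0" "f - g = f + - g"
    "a *\<^sub>R (f + g) = a *\<^sub>R f + a *\<^sub>R g" "(a + b) *\<^sub>R f = a *\<^sub>R f + b *\<^sub>R f"
    "a *\<^sub>R b *\<^sub>R f = (a * b) *\<^sub>R f" "1 *\<^sub>R f = f"
    by (rule grassmann_eqI; simp add: plus_grassmann.rep_eq uminus_grassmann.rep_eq minus_grassmann.rep_eq
        zero_grassmann.rep_eq scaleR_grassmann.rep_eq algebra_simps)+
qed

end

lift_definition gtheta :: "nat \<Rightarrow> grassmann" is "\<lambda>j K. if K = {j} then 1 else 0" by auto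

definition gbody :: "grassmann \<Rightarrow> real" where
  "gbody u = gcoef u {}"

definition gsoul :: "grassmann \<Rightarrow> grassmann" where
  "gsoul u = u - of_real (gbody u)"

text \<open>Component of parity \<open>\<epsilon>\<close>; only \<open>\<epsilon> mod 2\<close> matters.\<close>

lift_definition gpart :: "nat \<Rightarrow> grassmann \<Rightarrow> grassmann" is
  "\<lambda>\<epsilon> f K. if card K mod 2 = \<epsilon> mod 2 then f K else 0" by auto

definition has_parity :: "nat \<Rightarrow> grassmann \<Rightarrow> bool" where
  "has_parity \<epsilon> u \<longleftrightarrow> gpart \<epsilon> u = u"

text \<open>
  Value of a smooth real function on a Grassmann element \<open>b + n\<close> with body \<open>b\<close> and soul \<open>n\<close>, i.e. the
  Taylor expansion \<open>\<Sum>\<^sub>k F\<^bsup>(k)\<^esup>(b) n\<^bsup>k\<^esup> / k!\<close>.  At \<open>K\<close> only \<open>k \<le> card K\<close> contribute, because \<open>n\<^bsup>k\<^esup>\<close> has no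
  components of degree below \<open>k\<close>.
\<close>

lift_definition glift :: "(real \<Rightarrow> real) \<Rightarrow> grassmann \<Rightarrow> grassmann" is
  "\<lambda>F u K. if finite K
     then \<Sum>k\<le>card K. (deriv ^^ k) F (gbody u) / fact k * gcoef (gsoul u ^ k) K else 0" by simp

abbreviation gexp :: "grassmann \<Rightarrow> grassmann" where "gexp \<equiv> glift exp"
abbreviation gln :: "grassmann \<Rightarrow> grassmann" where "gln \<equiv> glift ln"
abbreviation gsqrt :: "grassmann \<Rightarrow> grassmann" where "gsqrt \<equiv> glift sqrt"
abbreviation ginv :: "grassmann \<Rightarrow> grassmann" where "ginv \<equiv> glift inverse"


section \<open>Superdomains\<close>

text \<open>
  Points of \<open>\<real>\<^bsup>p\<^esup>\<close> are those of \<^const>\<open>Euclidean_space\<close>.  A superfunction on an open \<open>V \<subseteq> \<real>\<^bsup>p\<^esup>\<close>, i.e. an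
  element of \<open>C\<^bsup>\<infinity>\<^esup>(V) \<otimes> \<Lambda>(\<theta>\<^sub>0, \<dots>, \<theta>\<^bsub>q-1\<^esub>)\<close>, is a Grassmann-valued function, considered on \<open>V\<close> only.
\<close>

type_synonym superfun = "(nat \<Rightarrow> real) \<Rightarrow> grassmann"

definition partial :: "nat \<Rightarrow> ((nat \<Rightarrow> real) \<Rightarrow> real) \<Rightarrow> (nat \<Rightarrow> real) \<Rightarrow> real" where
  "partial i g x = deriv (\<lambda>t. g (x(i := t))) (x i)"

fun partials :: "nat list \<Rightarrow> ((nat \<Rightarrow> real) \<Rightarrow> real) \<Rightarrow> (nat \<Rightarrow> real) \<Rightarrow> real" where
  "partials [] g = g"
| "partials (i # is) g = partial i (partials is g)"

definition smooth_on :: "nat \<Rightarrow> (nat \<Rightarrow> real) set \<Rightarrow> ((nat \<Rightarrow> real) \<Rightarrow> real) \<Rightarrow> bool" where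
  "smooth_on p V g \<longleftrightarrow> (\<forall>is. set is \<subseteq> {..<p} \<longrightarrow>
     continuous_map (subtopology (Euclidean_space p) V) euclideanreal (partials is g) \<and>
     (\<forall>i<p. \<forall>x\<in>V. (\<lambda>t. partials is g (x(i := t))) differentiable at (x i)))"

definition superfunction_on :: "nat \<Rightarrow> nat \<Rightarrow> (nat \<Rightarrow> real) set \<Rightarrow> superfun \<Rightarrow> bool" where
  "superfunction_on p q V f \<longleftrightarrow>
     (\<forall>K. smooth_on p V (\<lambda>x. gcoef (f x) K)) \<and>
     (\<forall>x\<in>V. \<forall>K. gcoef (f x) K \<noteq> 0 \<longrightarrow> K \<subseteq> {..<q})"

text \<open>
  The coordinates on \<open>\<real>\<^bsup>p|q\<^esup>\<close> are indexed by \<open>a < p + q\<close>: first \<open>p\<close> even ones, then \<open>q\<close> odd ones.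
\<close>

definition cpar :: "nat \<Rightarrow> nat \<Rightarrow> nat" where
  "cpar p a = (if a < p then 0 else 1)"

definition coord :: "nat \<Rightarrow> nat \<Rightarrow> superfun" where
  "coord p a x = (if a < p then of_real (x a) else gtheta (a - p))"

lift_definition even_deriv :: "nat \<Rightarrow> superfun \<Rightarrow> superfun" is
  "\<lambda>i f x K. if finite K then partial i (\<lambda>z. f z K) x else 0" by simp

text \<open>Left derivative: \<open>\<partial>/\<partial>\<theta>\<^sub>j\<close> sends \<open>\<theta>\<^sub>j \<theta>\<^sub>K\<close> to \<open>\<theta>\<^sub>K\<close> if \<open>j \<notin> K\<close>.\<close>

lift_definition gderiv_theta :: "nat \<Rightarrow> grassmann \<Rightarrow> grassmann" is
  "\<lambda>j f K. if j \<in> K then 0 else (- 1) ^ card {i \<in> K. i < j} * f (insert j K)" by simp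

definition pd :: "nat \<Rightarrow> nat \<Rightarrow> superfun \<Rightarrow> superfun" where
  "pd p a f = (if a < p then even_deriv a f else (\<lambda>x. gderiv_theta (a - p) (f x)))"

text \<open>
  Substitution \<open>f(y)\<close> of superfunctions \<open>y\<^sup>0, \<dots>, y\<^bsup>p+q-1\<^esup>\<close> for the coordinates of a superdomain of dimension
  \<open>p|q\<close>: even coordinates are substituted by Taylor expansion around the body, odd ones literally.
  The \<open>y\<close>'s involve at most \<open>q\<close> odd variables, so products of more than \<open>q\<close> souls vanish.
\<close>

definition super_body :: "nat \<Rightarrow> (nat \<Rightarrow> superfun) \<Rightarrow> (nat \<Rightarrow> real) \<Rightarrow> nat \<Rightarrow> real" where
  "super_body p y x = (\<lambda>i. if i < p then gbody (y i x) else 0)"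

definition subst_super :: "nat \<Rightarrow> nat \<Rightarrow> superfun \<Rightarrow> (nat \<Rightarrow> superfun) \<Rightarrow> superfun" where
  "subst_super p q f y x =
     (\<Sum>I\<in>Pow {..<q}. \<Sum>k\<le>q. \<Sum>is | length is = k \<and> set is \<subseteq> {..<p}.
        (partials is (\<lambda>z. gcoef (f z) I) (super_body p y x) / fact k) *\<^sub>R
          (prod_list (map (\<lambda>i. gsoul (y i x)) is) *
           prod_list (map (\<lambda>j. y (p + j) x) (sorted_list_of_set I))))"


section \<open>Berezinian\<close>

text \<open>
  The matrices below have commuting (even) entries, so the order of factors is immaterial;
  \<^const>\<open>det\<close> needs a commutative ring type.
\<close>

definition gdet :: "nat \<Rightarrow> (nat \<Rightarrow> nat \<Rightarrow> grassmann) \<Rightarrow> grassmann" where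
  "gdet n A = (\<Sum>\<pi> | \<pi> permutes {..<n}. of_int (sign \<pi>) * prod_list (map (\<lambda>i. A i (\<pi> i)) [0..<n]))"

definition gmat_inv :: "nat \<Rightarrow> (nat \<Rightarrow> nat \<Rightarrow> grassmann) \<Rightarrow> nat \<Rightarrow> nat \<Rightarrow> grassmann" where
  "gmat_inv n A = (SOME B. \<forall>i<n. \<forall>j<n.
     (\<Sum>k<n. A i k * B k j) = (if i = j then 1 else 0) \<and>
     (\<Sum>k<n. B i k * A k j) = (if i = j then 1 else 0))"

definition berezinian :: "nat \<Rightarrow> nat \<Rightarrow> (nat \<Rightarrow> nat \<Rightarrow> grassmann) \<Rightarrow> grassmann" where
  "berezinian p q J =
     (let D' = gmat_inv q (\<lambda>i j. J (p + i) (p + j))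
      in gdet p (\<lambda>i j. J i j - (\<Sum>k<q. \<Sum>l<q. J i (p + k) * D' k l * J (p + l) j))
         * ginv (gdet q (\<lambda>i j. J (p + i) (p + j))))"

text \<open>\<open>Dy = super_jac p q y \<cdot> Dx\<close>\<close>

definition super_jac :: "nat \<Rightarrow> nat \<Rightarrow> (nat \<Rightarrow> superfun) \<Rightarrow> superfun" where
  "super_jac p q y x = berezinian p q (\<lambda>a b. pd p a (y b) x)"


section \<open>Supermanifolds\<close>

text \<open>
  A supermanifold is given by an atlas on its underlying topological space.  \<open>sm_trans M \<alpha> \<beta> b\<close> is
  the \<open>b\<close>-th coordinate of the chart \<open>\<beta>\<close> expressed through the coordinates of the chart \<open>\<alpha>\<close>.
\<close>

record ('m, 'i) supermfd =
  sm_top :: "'m topology"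
  sm_even :: nat
  sm_odd :: nat
  sm_charts :: "'i set"
  sm_dom :: "'i \<Rightarrow> 'm set"
  sm_map :: "'i \<Rightarrow> 'm \<Rightarrow> nat \<Rightarrow> real"
  sm_trans :: "'i \<Rightarrow> 'i \<Rightarrow> nat \<Rightarrow> superfun"

definition sm_img :: "('m, 'i) supermfd \<Rightarrow> 'i \<Rightarrow> (nat \<Rightarrow> real) set" where
  "sm_img M \<alpha> = sm_map M \<alpha> ` sm_dom M \<alpha>"

definition sm_overlap :: "('m, 'i) supermfd \<Rightarrow> 'i \<Rightarrow> 'i \<Rightarrow> (nat \<Rightarrow> real) set" where
  "sm_overlap M \<alpha> \<beta> = sm_map M \<alpha> ` (sm_dom M \<alpha> \<inter> sm_dom M \<beta>)"

definition supermanifold :: "('m, 'i) supermfd \<Rightarrow> bool" where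
  "supermanifold M \<longleftrightarrow>
     (let X = sm_top M; p = sm_even M; q = sm_odd M; A = sm_charts M; U = sm_dom M; \<phi> = sm_map M;
          y = sm_trans M
      in Hausdorff_space X \<and> second_countable X \<and> (\<Union>\<alpha>\<in>A. U \<alpha>) = topspace X \<and>
         (\<forall>\<alpha>\<in>A. openin X (U \<alpha>) \<and> openin (Euclidean_space p) (sm_img M \<alpha>) \<and>
            homeomorphic_map (subtopology X (U \<alpha>)) (subtopology (Euclidean_space p) (sm_img M \<alpha>)) (\<phi> \<alpha>)) \<and>
         (\<forall>\<alpha>\<in>A. \<forall>\<beta>\<in>A. \<forall>b<p + q.
            superfunction_on p q (sm_overlap M \<alpha> \<beta>) (y \<alpha> \<beta> b) \<and>
            (\<forall>x\<in>sm_overlap M \<alpha> \<beta>. has_parity (cpar p b) (y \<alpha> \<beta> b x))) \<and>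
         (\<forall>\<alpha>\<in>A. \<forall>\<beta>\<in>A. \<forall>m\<in>U \<alpha> \<inter> U \<beta>. super_body p (y \<alpha> \<beta>) (\<phi> \<alpha> m) = \<phi> \<beta> m) \<and>
         (\<forall>\<alpha>\<in>A. \<forall>x\<in>sm_img M \<alpha>. \<forall>a<p + q. y \<alpha> \<alpha> a x = coord p a x) \<and>
         (\<forall>\<alpha>\<in>A. \<forall>\<beta>\<in>A. \<forall>\<gamma>\<in>A. \<forall>m\<in>U \<alpha> \<inter> U \<beta> \<inter> U \<gamma>. \<forall>c<p + q.
            y \<alpha> \<gamma> c (\<phi> \<alpha> m) = subst_super p q (y \<beta> \<gamma> c) (y \<alpha> \<beta>) (\<phi> \<alpha> m)))"

text \<open>
  Orientation in the sense needed for Berezin volume forms: all coordinate changes have Berezinian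
  with positive body.
\<close>

definition oriented_supermanifold :: "('m, 'i) supermfd \<Rightarrow> bool" where
  "oriented_supermanifold M \<longleftrightarrow> supermanifold M \<and>
     (\<forall>\<alpha>\<in>sm_charts M. \<forall>\<beta>\<in>sm_charts M. \<forall>x\<in>sm_overlap M \<alpha> \<beta>.
        0 < gbody (super_jac (sm_even M) (sm_odd M) (sm_trans M \<alpha> \<beta>) x))"

text \<open>
  Functions, volume forms and half-densities on \<open>M\<close> are represented by their coefficients in all
  charts, which agree on overlaps up to the appropriate power of the Berezinian.  Only the values
  on \<^const>\<open>sm_img\<close> are meaningful, so equality is \<open>sm_eq\<close>.
\<close>

type_synonym 'i local_coeffs = "'i \<Rightarrow> superfun"

definition sm_eq :: "('m, 'i) supermfd \<Rightarrow> 'i local_coeffs \<Rightarrow> 'i local_coeffs \<Rightarrow> bool" where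
  "sm_eq M f g \<longleftrightarrow> (\<forall>\<alpha>\<in>sm_charts M. \<forall>x\<in>sm_img M \<alpha>. f \<alpha> x = g \<alpha> x)"

definition density_with :: "(grassmann \<Rightarrow> grassmann) \<Rightarrow> ('m, 'i) supermfd \<Rightarrow> 'i local_coeffs \<Rightarrow> bool" where
  "density_with w M f \<longleftrightarrow>
     (\<forall>\<alpha>\<in>sm_charts M. superfunction_on (sm_even M) (sm_odd M) (sm_img M \<alpha>) (f \<alpha>)) \<and>
     (\<forall>\<alpha>\<in>sm_charts M. \<forall>\<beta>\<in>sm_charts M. \<forall>x\<in>sm_overlap M \<alpha> \<beta>.
        f \<alpha> x = subst_super (sm_even M) (sm_odd M) (f \<beta>) (sm_trans M \<alpha> \<beta>) x
                * w (super_jac (sm_even M) (sm_odd M) (sm_trans M \<alpha> \<beta>) x))"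

definition sm_function :: "('m, 'i) supermfd \<Rightarrow> 'i local_coeffs \<Rightarrow> bool" where
  "sm_function M = density_with (\<lambda>_. 1) M"

definition even_function :: "('m, 'i) supermfd \<Rightarrow> 'i local_coeffs \<Rightarrow> bool" where
  "even_function M f \<longleftrightarrow> sm_function M f \<and> (\<forall>\<alpha>\<in>sm_charts M. \<forall>x\<in>sm_img M \<alpha>. has_parity 0 (f \<alpha> x))"

definition half_density :: "('m, 'i) supermfd \<Rightarrow> 'i local_coeffs \<Rightarrow> bool" where
  "half_density M = density_with gsqrt M"

text \<open>Even, with positive coefficients (which are then invertible).\<close>

definition nondegenerate_volume_form :: "('m, 'i) supermfd \<Rightarrow> 'i local_coeffs \<Rightarrow> bool" where
  "nondegenerate_volume_form M \<rho> \<longleftrightarrow> density_with (\<lambda>J. J) M \<rho> \<and>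
     (\<forall>\<alpha>\<in>sm_charts M. \<forall>x\<in>sm_img M \<alpha>. has_parity 0 (\<rho> \<alpha> x) \<and> 0 < gbody (\<rho> \<alpha> x))"


section \<open>Odd Poisson structures\<close>

text \<open>
  The cotangent bundle of a superdomain of dimension \<open>p|q\<close> has dimension \<open>2p|2q\<close>; its even coordinates are
  the even \<open>x\<^sup>a\<close> followed by the even \<open>p\<^sub>a\<close>, and likewise for the odd ones.
\<close>

definition ct_x :: "nat \<Rightarrow> nat \<Rightarrow> nat" where
  "ct_x p a = (if a < p then a else p + a)"

definition ct_p :: "nat \<Rightarrow> nat \<Rightarrow> nat \<Rightarrow> nat" where
  "ct_p p q a = (if a < p then p + a else p + q + a)"

definition ct_base :: "nat \<Rightarrow> (nat \<Rightarrow> real) \<Rightarrow> nat \<Rightarrow> real" where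
  "ct_base p z = (\<lambda>i. if i < p then z i else 0)"

definition momentum :: "nat \<Rightarrow> nat \<Rightarrow> nat \<Rightarrow> superfun" where
  "momentum p q a = coord (2 * p) (ct_p p q a)"

text \<open>
  Coordinate change on the cotangent bundle induced by \<open>y = y(x)\<close> with inverse \<open>x = x(y)\<close>:
  the new momenta are \<open>p'\<^sub>b = (\<partial>x\<^sup>a/\<partial>y\<^sup>b)(y(x)) p\<^sub>a\<close>.
\<close>

definition ct_trans ::
    "nat \<Rightarrow> nat \<Rightarrow> (nat \<Rightarrow> superfun) \<Rightarrow> (nat \<Rightarrow> superfun) \<Rightarrow> nat \<Rightarrow> superfun" where
  "ct_trans p q y y_inv c z =
     (let new_x = (\<lambda>b. y b (ct_base p z));
          new_p = (\<lambda>b. \<Sum>a<p + q. subst_super p q (pd p b (y_inv a)) y (ct_base p z) * momentum p q a z)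
      in if c < p then new_x c
         else if c < 2 * p then new_p (c - p)
         else if c < 2 * p + q then new_x (c - p)
         else new_p (c - p - q))"

text \<open>
  Canonical even Poisson bracket on the cotangent bundle, normalised by \<open>(p\<^sub>a, x\<^sup>b) = \<delta>\<^sub>a\<^sup>b\<close>:
  \<open>(F, G) = (-1)\<^bsup>a(F+1)\<^esup> \<partial>F/\<partial>p\<^sub>a \<partial>G/\<partial>x\<^sup>a - (-1)\<^bsup>aF\<^esup> \<partial>F/\<partial>x\<^sup>a \<partial>G/\<partial>p\<^sub>a\<close> for homogeneous \<open>F\<close>.
  This is the normalisation for which \<open>(f, (S, g))\<close> is \<open>odd_bracket\<close> below.
\<close>

definition canonical_bracket :: "nat \<Rightarrow> nat \<Rightarrow> superfun \<Rightarrow> superfun \<Rightarrow> superfun" where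
  "canonical_bracket p q F G z = (\<Sum>\<epsilon><2. \<Sum>a<p + q.
     (let F\<^sub>\<epsilon> = (\<lambda>z. gpart \<epsilon> (F z)); dx = pd (2 * p) (ct_x p a); dp = pd (2 * p) (ct_p p q a)
      in (- 1) ^ (cpar p a * (\<epsilon> + 1)) * dp F\<^sub>\<epsilon> z * dx G z
         - (- 1) ^ (cpar p a * \<epsilon>) * dx F\<^sub>\<epsilon> z * dp G z))"

definition schouten_ham :: "nat \<Rightarrow> nat \<Rightarrow> (nat \<Rightarrow> nat \<Rightarrow> superfun) \<Rightarrow> superfun" where
  "schouten_ham p q S z = (1 / 2) *\<^sub>R
     (\<Sum>a<p + q. \<Sum>b<p + q. S a b (ct_base p z) * momentum p q b z * momentum p q a z)"

definition odd_poisson :: "('m, 'i) supermfd \<Rightarrow> ('i \<Rightarrow> nat \<Rightarrow> nat \<Rightarrow> superfun) \<Rightarrow> bool" where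
  "odd_poisson M S \<longleftrightarrow>
     (let p = sm_even M; q = sm_odd M
      in (\<forall>\<alpha>\<in>sm_charts M. \<forall>a<p + q. \<forall>b<p + q.
            superfunction_on p q (sm_img M \<alpha>) (S \<alpha> a b) \<and>
            (\<forall>x\<in>sm_img M \<alpha>. has_parity (cpar p a + cpar p b + 1) (S \<alpha> a b x) \<and>
               S \<alpha> a b x = (- 1) ^ (cpar p a * cpar p b) * S \<alpha> b a x)) \<and>
         (\<forall>\<alpha>\<in>sm_charts M. \<forall>\<beta>\<in>sm_charts M. \<forall>z\<in>topspace (Euclidean_space (2 * p)).
            ct_base p z \<in> sm_overlap M \<alpha> \<beta> \<longrightarrow>
            schouten_ham p q (S \<alpha>) z =
              subst_super (2 * p) (2 * q) (schouten_ham p q (S \<beta>))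
                (ct_trans p q (sm_trans M \<alpha> \<beta>) (sm_trans M \<beta> \<alpha>)) z) \<and>
         (\<forall>\<alpha>\<in>sm_charts M. \<forall>z\<in>topspace (Euclidean_space (2 * p)). ct_base p z \<in> sm_img M \<alpha> \<longrightarrow>
            canonical_bracket p q (schouten_ham p q (S \<alpha>)) (schouten_ham p q (S \<alpha>)) z = 0))"


section \<open>Bracket, Hamiltonian vector fields, divergence, odd Laplacians\<close>

text \<open>
  Formulas whose signs depend on the parity of an argument \<open>f\<close> are extended to inhomogeneous \<open>f\<close> by
  linearity, through the components \<open>gpart \<epsilon> f\<close>.
\<close>

definition odd_bracket :: "nat \<Rightarrow> nat \<Rightarrow> (nat \<Rightarrow> nat \<Rightarrow> superfun) \<Rightarrow> superfun \<Rightarrow> superfun \<Rightarrow> superfun" where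
  "odd_bracket p q S f g x = (\<Sum>\<epsilon><2. \<Sum>a<p + q. \<Sum>b<p + q.
     - ((- 1) ^ (\<epsilon> * (cpar p a + 1)) * S a b x * pd p b (\<lambda>x. gpart \<epsilon> (f x)) x * pd p a g x))"

text \<open>Components of \<open>X\<^sub>f\<close> for \<open>f\<close> homogeneous of parity \<open>\<epsilon>\<close>.\<close>

definition ham_vf ::
    "nat \<Rightarrow> nat \<Rightarrow> (nat \<Rightarrow> nat \<Rightarrow> superfun) \<Rightarrow> nat \<Rightarrow> superfun \<Rightarrow> nat \<Rightarrow> superfun" where
  "ham_vf p q S \<epsilon> f a x = (\<Sum>b<p + q. (- 1) ^ (cpar p a * \<epsilon>) * S a b x * pd p b f x)"

text \<open>Divergence of a vector field \<open>X\<close> homogeneous of parity \<open>\<epsilon>\<close>.\<close>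

definition super_div :: "nat \<Rightarrow> nat \<Rightarrow> superfun \<Rightarrow> nat \<Rightarrow> (nat \<Rightarrow> superfun) \<Rightarrow> superfun" where
  "super_div p q \<rho> \<epsilon> X x =
     ginv (\<rho> x) * (\<Sum>a<p + q. (- 1) ^ (cpar p a * (\<epsilon> + 1)) * pd p a (\<lambda>x. \<rho> x * X a x) x)"

text \<open>\<open>\<Delta>\<^sub>\<rho> f = div\<^sub>\<rho> X\<^sub>f\<close>, where \<open>X\<^sub>f\<close> has parity opposite to \<open>f\<close>.\<close>

definition odd_laplace ::
    "('m, 'i) supermfd \<Rightarrow> ('i \<Rightarrow> nat \<Rightarrow> nat \<Rightarrow> superfun) \<Rightarrow> 'i local_coeffs \<Rightarrow> 'i local_coeffs \<Rightarrow> 'i local_coeffs" where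
  "odd_laplace M S \<rho> f \<alpha> x =
     (let p = sm_even M; q = sm_odd M
      in \<Sum>\<epsilon><2. super_div p q (\<rho> \<alpha>) (\<epsilon> + 1) (ham_vf p q (S \<alpha>) \<epsilon> (\<lambda>x. gpart \<epsilon> (f \<alpha> x))) x)"

definition half_laplace ::
    "('m, 'i) supermfd \<Rightarrow> ('i \<Rightarrow> nat \<Rightarrow> nat \<Rightarrow> superfun) \<Rightarrow> 'i local_coeffs \<Rightarrow> 'i local_coeffs \<Rightarrow> 'i local_coeffs" where
  "half_laplace M S \<rho> s \<alpha> x =
     gsqrt (\<rho> \<alpha> x) * odd_laplace M S \<rho> (\<lambda>\<alpha> x. s \<alpha> x * ginv (gsqrt (\<rho> \<alpha> x))) \<alpha> x"

definition mfd_bracket ::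
    "('m, 'i) supermfd \<Rightarrow> ('i \<Rightarrow> nat \<Rightarrow> nat \<Rightarrow> superfun) \<Rightarrow> 'i local_coeffs \<Rightarrow> 'i local_coeffs \<Rightarrow> 'i local_coeffs" where
  "mfd_bracket M S f g \<alpha> = odd_bracket (sm_even M) (sm_odd M) (S \<alpha>) (f \<alpha>) (g \<alpha>)"

text \<open>\<open>H(\<rho>', \<rho>) = \<Delta>\<^sub>\<rho> \<tau> - \<onehalf>{\<tau>, \<tau>}\<close> with \<open>\<tau> = ln (\<rho>'/\<rho>)\<close>.\<close>

definition master_H ::
    "('m, 'i) supermfd \<Rightarrow> ('i \<Rightarrow> nat \<Rightarrow> nat \<Rightarrow> superfun) \<Rightarrow> 'i local_coeffs \<Rightarrow> 'i local_coeffs \<Rightarrow> 'i local_coeffs" where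
  "master_H M S \<rho>' \<rho> \<alpha> x =
     (let \<tau> = (\<lambda>\<alpha> x. gln (\<rho>' \<alpha> x * ginv (\<rho> \<alpha> x)))
      in odd_laplace M S \<rho> \<tau> \<alpha> x - (1 / 2) *\<^sub>R mfd_bracket M S \<tau> \<tau> \<alpha> x)"

text \<open>\<open>e\<^bsup>-\<sigma>/2\<^esup> \<Delta>\<^sub>\<rho>(e\<^bsup>\<sigma>/2\<^esup>)\<close>\<close>

definition conj_laplace ::
    "('m, 'i) supermfd \<Rightarrow> ('i \<Rightarrow> nat \<Rightarrow> nat \<Rightarrow> superfun) \<Rightarrow> 'i local_coeffs \<Rightarrow> 'i local_coeffs \<Rightarrow> 'i local_coeffs" where
  "conj_laplace M S \<rho> \<sigma> \<alpha> x =
     gexp (- (1 / 2) *\<^sub>R \<sigma> \<alpha> x) * odd_laplace M S \<rho> (\<lambda>\<alpha> x. gexp ((1 / 2) *\<^sub>R \<sigma> \<alpha> x)) \<alpha> x"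

end

(* In a chart, for u of any parity, Delta_rho u = rho^-1 sum_ab d_a (rho S^ab d_b u).  Put E = e^(sigma/2),
   so that rho' = E^2 rho, and u = E v.  Then E^2 d_b v = E d_b u - (d_b E) u, and since S is symmetric the
   terms containing first derivatives of u cancel:
     sum d_a (E^2 rho S^ab d_b v) = E sum d_a (rho S^ab d_b u) - (sum d_a (rho S^ab d_b E)) u.
   This is the transformation law of the Laplacian on half-densities.  The formula for H follows from
   d E = (1/2) E d sigma and the Leibniz rule. *)

theory Submission
  imports Defs
begin

section \<open>Supercommutativity\<close>

text \<open>The overview computes with the usual laws of products, exponentials, logarithms and
  roots, and none of these is free here. Multiplication in \<open>grassmann\<close> is only
  supercommutative: \<sigma>, \<rho> and whatever is lifted from them are even, hence central, while
  S^ab and the derivatives need not be. The signs disappear because S^ab d_b E has the parity of a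
  plus one, so that d_a passes it with sign (-1)^(a(a+1)) = 1; the function u stays at the right end
  of each product, which is why its parity is arbitrary. The functional laws cannot be read off from
  finite Taylor polynomials: the type has infinitely many generators, so a soul need not be
  nilpotent. What is finite is each coefficient, since the one at K depends only on the Taylor
  polynomial of degree card K. Derivatives are therefore computed on truncations, one coefficient at
  a time, and the laws are derived from differential equations along the segment from a body to the
  element, where an induction on K takes the place of a uniqueness theorem.\<close>

lemma gcoef_add [simp]: "gcoef (u + v) K = gcoef u K + gcoef v K"
  and gcoef_diff [simp]: "gcoef (u - v) K = gcoef u K - gcoef v K"
  and gcoef_scaleR [simp]: "gcoef (c *\<^sub>R u) K = c * gcoef u K"
  and gcoef_zero [simp]: "gcoef 0 K = 0"
  and gcoef_one: "gcoef 1 K = (if K = {} then 1 else 0)"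
  by (simp_all add: plus_grassmann.rep_eq minus_grassmann.rep_eq
      scaleR_grassmann.rep_eq zero_grassmann.rep_eq one_grassmann.rep_eq)

lemma gcoef_of_real: "gcoef (of_real c) K = (if K = {} then c else 0)"
  by (simp add: of_real_def gcoef_one)

lemma gcoef_sum [simp]: "gcoef (\<Sum>a\<in>A. f a) K = (\<Sum>a\<in>A. gcoef (f a) K)"
  by (induction A rule: infinite_finite_induct) simp_all

lemma gcoef_mult: "finite K \<Longrightarrow>
    gcoef (u * v) K = (\<Sum>I\<in>Pow K. shuffle_sign I (K - I) * gcoef u I * gcoef v (K - I))"
  by (simp add: times_grassmann.rep_eq)

lemma gcoef_gpart: "gcoef (gpart \<epsilon> u) K = (if card K mod 2 = \<epsilon> mod 2 then gcoef u K else 0)"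
  by (simp add: gpart.rep_eq)

text \<open>Written as a shuffle sign, the sign of the derivative obeys the multiplicativity laws
  that the Leibniz rule needs.\<close>

lemma gcoef_gderiv_theta:
  "gcoef (gderiv_theta j u) K = (if j \<in> K then 0 else shuffle_sign {j} K * gcoef u (insert j K))"
proof -
  have "{(i, k). i \<in> {j} \<and> k \<in> K \<and> k < i} = Pair j ` {k \<in> K. k < j}" by auto
  then have "card {(i, k). i \<in> {j} \<and> k \<in> K \<and> k < i} = card {k \<in> K. k < j}"
    by (simp add: card_image inj_on_def)
  then show ?thesis by (simp add: gderiv_theta.rep_eq shuffle_sign_def)
qed

lemma gcoef_mult_cong:
  assumes "\<And>I. I \<subseteq> K \<Longrightarrow> gcoef u I = gcoef u' I" "\<And>I. I \<subseteq> K \<Longrightarrow> gcoef v I = gcoef v' I"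
  shows "gcoef (u * v) K = gcoef (u' * v') K"
  by (cases "finite K") (auto simp: gcoef_mult gcoef_infinite assms intro!: sum.cong)

lemma has_parity_iff:
  "has_parity \<epsilon> u \<longleftrightarrow> (\<forall>K. finite K \<longrightarrow> gcoef u K \<noteq> 0 \<longrightarrow> card K mod 2 = \<epsilon> mod 2)"
proof
  assume "has_parity \<epsilon> u"
  then have "gcoef (gpart \<epsilon> u) K = gcoef u K" for K by (simp add: has_parity_def)
  then show "\<forall>K. finite K \<longrightarrow> gcoef u K \<noteq> 0 \<longrightarrow> card K mod 2 = \<epsilon> mod 2"
    by (metis gcoef_gpart)
next
  assume *: "\<forall>K. finite K \<longrightarrow> gcoef u K \<noteq> 0 \<longrightarrow> card K mod 2 = \<epsilon> mod 2"
  show "has_parity \<epsilon> u" unfolding has_parity_def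
    by (rule grassmann_eqI) (use * in \<open>auto simp: gcoef_gpart\<close>)
qed

section \<open>Parity of sums, products and powers\<close>

lemma has_parity_add: "has_parity \<epsilon> u \<Longrightarrow> has_parity \<epsilon> v \<Longrightarrow> has_parity \<epsilon> (u + v)"
  by (fastforce simp: has_parity_iff)

lemma has_parity_diff: "has_parity \<epsilon> u \<Longrightarrow> has_parity \<epsilon> v \<Longrightarrow> has_parity \<epsilon> (u - v)"
  by (fastforce simp: has_parity_iff)

lemma has_parity_scaleR: "has_parity \<epsilon> u \<Longrightarrow> has_parity \<epsilon> (c *\<^sub>R u)"
  by (auto simp: has_parity_iff)

lemma has_parity_0_of_real: "has_parity 0 (of_real c)"
  by (auto simp: has_parity_iff gcoef_of_real split: if_splits)

lemma has_parity_mult: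
  assumes "has_parity \<epsilon> u" "has_parity \<delta> v"
  shows "has_parity (\<epsilon> + \<delta>) (u * v)"
  unfolding has_parity_iff
proof (intro allI impI)
  fix K :: "nat set" assume K: "finite K" "gcoef (u * v) K \<noteq> 0"
  then obtain I where I: "I \<subseteq> K" "gcoef u I \<noteq> 0" "gcoef v (K - I) \<noteq> 0"
    by (auto simp: gcoef_mult elim!: sum.not_neutral_contains_not_neutral)
  then have "card I mod 2 = \<epsilon> mod 2" "card (K - I) mod 2 = \<delta> mod 2"
    using assms K finite_subset[of _ K] by (auto simp: has_parity_iff)
  moreover have "card K = card I + card (K - I)"
    using I K by (metis Diff_disjoint Un_Diff_cancel card_Un_disjoint finite_Diff finite_subset sup.absorb2)
  ultimately show "card K mod 2 = (\<epsilon> + \<delta>) mod 2" by (metis mod_add_cong)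
qed

lemma has_parity_0_power: "has_parity 0 u \<Longrightarrow> has_parity 0 (u ^ k)"
proof (induction k)
  case 0
  show ?case using has_parity_0_of_real[of 1] by simp
next
  case (Suc k)
  then show ?case using has_parity_mult[of 0 u 0 "u ^ k"] by simp
qed

lemma has_parity_gpart: "has_parity \<epsilon> (gpart \<epsilon> u)"
  by (metis has_parity_iff gcoef_gpart)

lemma gpart_eq:
  assumes "has_parity \<epsilon> u"
  shows "gpart \<delta> u = (if \<epsilon> mod 2 = \<delta> mod 2 then u else 0)"
proof (rule grassmann_eqI)
  fix K :: "nat set" assume "finite K"
  then show "gcoef (gpart \<delta> u) K = gcoef (if \<epsilon> mod 2 = \<delta> mod 2 then u else 0) K"
    using assms[unfolded has_parity_iff, rule_format, of K]
    by (cases "gcoef u K = 0"; cases "\<epsilon> mod 2 = \<delta> mod 2") (simp_all only: gcoef_gpart simp_thms if_True if_False gcoef_zero not_False_eq_True if_cancel split: if_split)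
qed

lemma gpart_0_add_1: "gpart 0 u + gpart 1 u = u"
proof (rule grassmann_eqI)
  fix K :: "nat set"
  have "card K mod 2 = 0 \<or> card K mod 2 = 1" by presburger
  then show "gcoef (gpart 0 u + gpart 1 u) K = gcoef u K" by (auto simp: gcoef_gpart)
qed

text \<open>Each pair in the product of \<open>I\<close> and \<open>J\<close> is an inversion in
  exactly one of the two orders, so the two inversion counts add up to
  \<open>card I * card J\<close>.\<close>

lemma shuffle_sign_swap:
  assumes "finite I" "finite J" "I \<inter> J = {}"
  shows "shuffle_sign I J = (- 1) ^ (card I * card J) * shuffle_sign J I"
proof -
  let ?A = "{(i, j). i \<in> I \<and> j \<in> J \<and> j < i}" and ?B = "{(j, i). j \<in> J \<and> i \<in> I \<and> i < j}"
  have 1: "I \<times> J = ?A \<union> prod.swap ` ?B" 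
  proof (rule set_eqI)
    fix z :: "nat \<times> nat"
    obtain i j where z: "z = (i, j)" by fastforce
    have "i \<in> I \<Longrightarrow> j \<in> J \<Longrightarrow> i < j \<or> j < i" using assms(3) by (metis disjoint_iff nat_neq_iff)
    then show "z \<in> I \<times> J \<longleftrightarrow> z \<in> ?A \<union> prod.swap ` ?B" by (auto simp: z image_iff)
  qed
  have 2: "card (?A \<union> prod.swap ` ?B) = card ?A + card (prod.swap ` ?B)"
    by (rule card_Un_disjoint) (use assms finite_inversions in auto)
  have 3: "card (prod.swap ` ?B) = card ?B" by (intro card_image) simp
  have "card I * card J = card (I \<times> J)" by (simp add: card_cartesian_product)
  then have "card I * card J = card ?A + card ?B" by (simp only: 1 2 3)
  moreover have "(- 1 :: real) ^ n * (- 1) ^ n = 1" for n by (simp flip: power_mult_distrib)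
  ultimately show ?thesis unfolding shuffle_sign_def by (simp only: power_add mult.assoc mult_1_right)
qed

text \<open>Complementation inside \<open>K\<close> exchanges the factors, and wherever both
  coefficients are nonzero the swap sign depends only on the two parities.\<close>

lemma supercommute:
  assumes "has_parity \<epsilon> u" "has_parity \<delta> v"
  shows "u * v = (- 1) ^ (\<epsilon> * \<delta>) *\<^sub>R (v * u)"
proof (rule grassmann_eqI)
  fix K :: "nat set" assume K: "finite K"
  have "gcoef (u * v) K = (\<Sum>I\<in>Pow K. shuffle_sign I (K - I) * gcoef u I * gcoef v (K - I))"
    by (simp add: gcoef_mult K)
  also have "\<dots> = (\<Sum>I\<in>Pow K. (- 1) ^ (\<epsilon> * \<delta>) * (shuffle_sign I (K - I) * gcoef v I * gcoef u (K - I)))"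
  proof (rule sum.reindex_bij_witness[where i = "\<lambda>I. K - I" and j = "\<lambda>I. K - I"], goal_cases)
    case (5 I)
    then have I: "I \<subseteq> K" "K - (K - I) = I" by auto
    have fin: "finite I" "finite (K - I)" using K I finite_subset by auto
    show ?case
    proof (cases "gcoef u I = 0 \<or> gcoef v (K - I) = 0")
      case False
      then have "even (card I) = even \<epsilon>" "even (card (K - I)) = even \<delta>"
        using assms fin unfolding has_parity_iff by (metis even_iff_mod_2_eq_zero)+
      then have "(- 1) ^ (card I * card (K - I)) = ((- 1) ^ (\<epsilon> * \<delta>) :: real)"
        by (auto simp: minus_one_power_iff)
      then show ?thesis using shuffle_sign_swap[of I "K - I"] fin by (simp add: I)
    qed (auto simp: I)
  qed auto
  also have "\<dots> = gcoef ((- 1) ^ (\<epsilon> * \<delta>) *\<^sub>R (v * u)) K"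
    by (simp add: gcoef_mult K sum_distrib_left)
  finally show "gcoef (u * v) K = gcoef ((- 1) ^ (\<epsilon> * \<delta>) *\<^sub>R (v * u)) K" .
qed

text \<open>Splitting \<open>v\<close> into its even and odd part removes the homogeneity that
  \<open>supercommute\<close> asks of it.\<close>

lemma even_commute: "has_parity 0 u \<Longrightarrow> u * v = v * u"
  using supercommute[of 0 u 0 "gpart 0 v"] supercommute[of 0 u 1 "gpart 1 v"]
  by (metis distrib_left distrib_right gpart_0_add_1 has_parity_gpart mult_zero_left power_0 scaleR_one)

text \<open>The grading involution: it carries the sign that an odd derivative picks up when it
  passes a factor that need not be homogeneous.\<close>

definition ginvol :: "grassmann \<Rightarrow> grassmann" where
  "ginvol u = gpart 0 u - gpart 1 u"

lemma gcoef_ginvol: "gcoef (ginvol u) K = (- 1) ^ card K * gcoef u K"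
  by (cases "even (card K)") (simp_all add: ginvol_def gcoef_gpart odd_iff_mod_2_eq_one)

lemma ginvol_eq: "has_parity \<epsilon> u \<Longrightarrow> ginvol u = (- 1) ^ \<epsilon> *\<^sub>R u"
  by (rule grassmann_eqI) (simp add: gcoef_ginvol has_parity_iff,
      metis even_iff_mod_2_eq_zero minus_one_power_iff)

section \<open>The odd left derivative\<close>

lemma gderiv_theta_linear [simp]:
  "gderiv_theta j (u + v) = gderiv_theta j u + gderiv_theta j v"
  "gderiv_theta j (u - v) = gderiv_theta j u - gderiv_theta j v"
  "gderiv_theta j (c *\<^sub>R u) = c *\<^sub>R gderiv_theta j u"
  "gderiv_theta j 0 = 0"
  by (rule grassmann_eqI; simp add: gcoef_gderiv_theta algebra_simps)+

lemma gderiv_theta_of_real [simp]: "gderiv_theta j (of_real c) = 0"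
  by (rule grassmann_eqI) (simp add: gcoef_gderiv_theta gcoef_of_real)

lemma gderiv_theta_sum: "gderiv_theta j (\<Sum>a\<in>A. f a) = (\<Sum>a\<in>A. gderiv_theta j (f a))"
  by (induction A rule: infinite_finite_induct) simp_all

lemma has_parity_gderiv_theta:
  assumes "has_parity \<epsilon> u" shows "has_parity (\<epsilon> + 1) (gderiv_theta j u)"
  unfolding has_parity_iff
proof (intro allI impI)
  fix K assume K: "finite K" "gcoef (gderiv_theta j u) K \<noteq> 0"
  then have "j \<notin> K" "gcoef u (insert j K) \<noteq> 0" by (auto simp: gcoef_gderiv_theta split: if_splits)
  moreover from this have "Suc (card K) mod 2 = \<epsilon> mod 2"
    using assms K unfolding has_parity_iff by (metis card_insert_disjoint finite_insert)
  ultimately show "card K mod 2 = (\<epsilon> + 1) mod 2" by presburger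
qed

lemma shuffle_sign_square: "shuffle_sign I J * shuffle_sign I J = 1"
  unfolding shuffle_sign_def by (simp flip: power_mult_distrib)

lemma sum_Pow_insert:
  assumes "finite K" "j \<notin> K"
  shows "(\<Sum>I\<in>Pow (insert j K). f I) = (\<Sum>I\<in>Pow K. f I) + (\<Sum>I\<in>Pow K. f (insert j I))"
proof -
  have "(\<Sum>I\<in>Pow (insert j K). f I) = (\<Sum>I\<in>Pow K. f I) + (\<Sum>I\<in>insert j ` Pow K. f I)"
    unfolding Pow_insert by (rule sum.union_disjoint) (use assms in auto)
  also have "(\<Sum>I\<in>insert j ` Pow K. f I) = (\<Sum>I\<in>Pow K. f (insert j I))"
    by (subst sum.reindex) (use assms in \<open>auto simp: inj_on_def\<close>)
  finally show ?thesis .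
qed

lemma gderiv_theta_mult:
  "gderiv_theta j (u * v) = gderiv_theta j u * v + ginvol u * gderiv_theta j v"
proof (rule grassmann_eqI)
  fix K' :: "nat set" assume K': "finite K'"
  \<comment> \<open>Both cases are indexed by subsets without \<open>j\<close>, so that one table of
    signs serves them both.\<close>
  define K where "K = K' - {j}"
  have K: "finite K" "j \<notin> K" using K' by (auto simp: K_def)
  have signs: "shuffle_sign {j} K = shuffle_sign {j} I * shuffle_sign {j} (K - I)"
      "shuffle_sign (insert j I) (K - I) = shuffle_sign {j} (K - I) * shuffle_sign I (K - I)"
      "shuffle_sign I (insert j (K - I)) = (- 1) ^ card I * shuffle_sign {j} I * shuffle_sign I (K - I)"
      "j \<notin> I" "insert j K - insert j I = K - I" "insert j K - I = insert j (K - I)"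
      "card (insert j I) = Suc (card I)"
    if "I \<in> Pow K" for I
  proof -
    have I: "finite I" "finite (K - I)" "j \<notin> I" "I \<union> (K - I) = K" "j \<notin> K - I"
      using that K finite_subset by auto
    show "shuffle_sign {j} K = shuffle_sign {j} I * shuffle_sign {j} (K - I)"
      using shuffle_sign_Un_right[of "{j}" I "K - I"] I by simp
    show "shuffle_sign (insert j I) (K - I) = shuffle_sign {j} (K - I) * shuffle_sign I (K - I)"
      using shuffle_sign_Un_left[of "{j}" I "K - I"] I by simp
    have "shuffle_sign I (insert j (K - I)) = shuffle_sign I {j} * shuffle_sign I (K - I)"
      using shuffle_sign_Un_right[of I "{j}" "K - I"] I by simp
    also have "shuffle_sign I {j} = (- 1) ^ card I * shuffle_sign {j} I"
      using shuffle_sign_swap[of I "{j}"] I by simp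
    finally show "shuffle_sign I (insert j (K - I)) =
      (- 1) ^ card I * shuffle_sign {j} I * shuffle_sign I (K - I)" .
    show "j \<notin> I" "insert j K - insert j I = K - I" "insert j K - I = insert j (K - I)"
      "card (insert j I) = Suc (card I)"
      using that K I by auto
  qed
  have sq: "shuffle_sign I J * (shuffle_sign I J * r) = r" for I J r
    using shuffle_sign_square[of I J] by (simp flip: mult.assoc)
  show "gcoef (gderiv_theta j (u * v)) K' = gcoef (gderiv_theta j u * v + ginvol u * gderiv_theta j v) K'"
  proof (cases "j \<in> K'")
    case True
    then have eq: "K' = insert j K" by (auto simp: K_def)
    \<comment> \<open>A derivative in direction \<open>j\<close> contains no generator
      \<open>j\<close>, so the left side is zero here and the two products have to cancel.\<close>
    have "gcoef (gderiv_theta j u * v) K' =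
        (\<Sum>I\<in>Pow K. (- 1) ^ card I * shuffle_sign I (K - I) * gcoef u (insert j I) * gcoef v (insert j (K - I)))"
      unfolding eq gcoef_mult[OF finite.insertI[OF K(1)]] sum_Pow_insert[OF K]
      by (simp add: gcoef_gderiv_theta sum.neutral, rule sum.cong) (simp_all add: signs mult_ac sq shuffle_sign_square)
    moreover have "gcoef (ginvol u * gderiv_theta j v) K' =
        - (\<Sum>I\<in>Pow K. (- 1) ^ card I * shuffle_sign I (K - I) * gcoef u (insert j I) * gcoef v (insert j (K - I)))"
    proof -
      have "(\<Sum>I\<in>Pow K. shuffle_sign I (insert j K - I) * gcoef (ginvol u) I *
          gcoef (gderiv_theta j v) (insert j K - I)) = 0"
        by (rule sum.neutral) (auto simp: gcoef_gderiv_theta K)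
      then show ?thesis
        unfolding eq gcoef_mult[OF finite.insertI[OF K(1)]] sum_Pow_insert[OF K] sum_negf[symmetric]
        by (simp, intro sum.cong refl)
          (use K in \<open>simp_all add: signs gcoef_gderiv_theta gcoef_ginvol mult_ac sq shuffle_sign_square\<close>)
    qed
    ultimately show ?thesis by (simp add: gcoef_gderiv_theta True)
  next
    case False
    then have eq: "K' = K" by (simp add: K_def)
    \<comment> \<open>The subsets of \<open>insert j K\<close> are split by whether they contain
      \<open>j\<close>: those without it lead to the derivative of \<open>v\<close>, those with it
      to the derivative of \<open>u\<close>.\<close>
    have "gcoef (gderiv_theta j (u * v)) K' =
        (\<Sum>I\<in>Pow K. shuffle_sign {j} K *
          (shuffle_sign I (insert j K - I) * gcoef u I * gcoef v (insert j K - I))) +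
        (\<Sum>I\<in>Pow K. shuffle_sign {j} K * (shuffle_sign (insert j I) (insert j K - insert j I) *
          gcoef u (insert j I) * gcoef v (insert j K - insert j I)))"
      using K by (simp add: eq gcoef_gderiv_theta gcoef_mult sum_Pow_insert distrib_left sum_distrib_left)
    also have "\<dots> =
        (\<Sum>I\<in>Pow K. shuffle_sign I (K - I) * gcoef (ginvol u) I * gcoef (gderiv_theta j v) (K - I)) +
        (\<Sum>I\<in>Pow K. shuffle_sign I (K - I) * gcoef (gderiv_theta j u) I * gcoef v (K - I))"
      by (intro arg_cong2[of _ _ _ _ "(+)"] sum.cong refl)
        (use K in \<open>simp_all add: signs gcoef_gderiv_theta gcoef_ginvol mult_ac sq shuffle_sign_square\<close>)
    finally show ?thesis using K by (simp add: eq gcoef_mult)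
  qed
qed

section \<open>Taylor expansion in the soul\<close>

lemma gbody_simps [simp]:
  "gbody (u + v) = gbody u + gbody v" "gbody (u - v) = gbody u - gbody v"
  "gbody (c *\<^sub>R u) = c * gbody u" "gbody (u * v) = gbody u * gbody v" "gbody (of_real c) = c"
  by (simp_all add: gbody_def gcoef_mult gcoef_of_real)

lemma gbody_gsoul [simp]: "gbody (gsoul u) = 0"
  by (simp add: gsoul_def)

lemma has_parity_gsoul: "has_parity 0 u \<Longrightarrow> has_parity 0 (gsoul u)"
  by (simp add: gsoul_def has_parity_diff has_parity_0_of_real)

text \<open>Each factor \<open>n\<close> consumes at least one generator of \<open>K\<close>, its
  coefficient at the empty set being zero.\<close>

lemma gcoef_soul_power_mult:
  assumes "gbody n = 0" "finite K" "card K < k"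
  shows "gcoef (n ^ k * u) K = 0"
  using assms(2,3)
proof (induction k arbitrary: K)
  case 0
  then show ?case by simp
next
  case (Suc k)
  have "gcoef n I * gcoef (n ^ k * u) (K - I) = 0" if "I \<subseteq> K" for I
  proof (cases "I = {}")
    case True
    then show ?thesis using assms(1) by (simp add: gbody_def)
  next
    case False
    then have "card (K - I) < card K"
      using that Suc.prems by (intro psubset_card_mono) auto
    then show ?thesis using Suc by simp
  qed
  then show ?case
    by (simp add: gcoef_mult Suc.prems mult.assoc sum.neutral)
qed

text \<open>The order is fixed, while in \<open>glift\<close> it grows with \<open>K\<close>. This
  gives a single element to which derivations apply; every order from \<open>card K\<close> on
  yields the right coefficient at \<open>K\<close>.\<close>

definition gtaylor :: "(real \<Rightarrow> real) \<Rightarrow> nat \<Rightarrow> grassmann \<Rightarrow> grassmann" where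
  "gtaylor F N u = (\<Sum>k\<le>N. ((deriv ^^ k) F (gbody u) / fact k) *\<^sub>R gsoul u ^ k)"

lemma gcoef_glift:
  assumes "finite K" "card K \<le> N"
  shows "gcoef (glift F u) K = gcoef (gtaylor F N u) K"
proof -
  have "gcoef (glift F u) K = (\<Sum>k\<le>card K. (deriv ^^ k) F (gbody u) / fact k * gcoef (gsoul u ^ k) K)"
    using assms by (simp add: glift.rep_eq)
  also have "\<dots> = (\<Sum>k\<le>N. (deriv ^^ k) F (gbody u) / fact k * gcoef (gsoul u ^ k) K)"
    by (rule sum.mono_neutral_left)
      (use assms gcoef_soul_power_mult[of "gsoul u" K _ 1] in auto)
  finally show ?thesis by (simp add: gtaylor_def)
qed

lemma gcoef_glift_mult:
  assumes "finite K" "card K \<le> N"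
  shows "gcoef (glift F u * v) K = gcoef (gtaylor F N u * v) K"
proof (rule gcoef_mult_cong)
  fix I assume "I \<subseteq> K"
  then have "finite I" "card I \<le> N"
    using assms finite_subset card_mono order_trans by (metis, metis)
  then show "gcoef (glift F u) I = gcoef (gtaylor F N u) I" by (rule gcoef_glift)
qed simp

lemma gbody_glift [simp]: "gbody (glift F u) = F (gbody u)"
  by (simp add: gbody_def glift.rep_eq gcoef_one)

lemma glift_of_real [simp]: "glift F (of_real b) = of_real (F b)"
proof (rule grassmann_eqI)
  fix K :: "nat set" assume "finite K"
  have "gsoul (of_real b) = 0" by (simp add: gsoul_def)
  then have "gtaylor F N (of_real b) = of_real (F b)" for N
    by (induction N) (simp_all add: gtaylor_def scaleR_conv_of_real)
  then show "gcoef (glift F (of_real b)) K = gcoef (of_real (F b)) K"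
    using gcoef_glift[OF \<open>finite K\<close> order_refl] by simp
qed

lemma has_parity_glift:
  assumes "has_parity 0 u"
  shows "has_parity 0 (glift F u)"
  unfolding has_parity_iff
proof (intro allI impI)
  fix K assume K: "finite K" "gcoef (glift F u) K \<noteq> 0"
  then obtain k where "gcoef (gsoul u ^ k) K \<noteq> 0"
    by (auto simp: glift.rep_eq elim!: sum.not_neutral_contains_not_neutral)
  then show "card K mod 2 = 0 mod 2"
    using has_parity_0_power[OF has_parity_gsoul[OF assms], of k] K by (simp add: has_parity_iff)
qed

text \<open>Only the germ at the body matters. This allows \<open>inverse\<close> and
  \<open>sqrt\<close> to be replaced by real powers, with which they are compared on the positive
  half-line.\<close>

lemma glift_cong:
  assumes "\<forall>\<^sub>F b in nhds (gbody u). F b = G b"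
  shows "glift F u = glift G u"
proof -
  have "(deriv ^^ k) F (gbody u) = (deriv ^^ k) G (gbody u)" for k
    using assms by (intro higher_deriv_cong_ev) auto
  then show ?thesis by (intro grassmann_eqI) (simp add: glift.rep_eq)
qed

text \<open>Differentiating a Taylor polynomial termwise lowers its order by one: the constant term
  drops out and \<open>k / fact k\<close> becomes \<open>1 / fact (k - 1)\<close>.\<close>

lemma even_power_deriv_sum:
  fixes n d :: grassmann
  assumes "d * n = n * d"
  shows "(\<Sum>k\<le>Suc N. (a k / fact k) *\<^sub>R (real k *\<^sub>R (n ^ (k - 1) * d)))
    = (\<Sum>k\<le>N. (a (Suc k) / fact k) *\<^sub>R n ^ k) * d"
  unfolding sum.atMost_Suc_shift sum_distrib_right
  by (simp add: field_simps del: of_nat_Suc)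

lemma gderiv_theta_even_power:
  assumes "has_parity 0 n"
  shows "gderiv_theta j (n ^ k) = real k *\<^sub>R (n ^ (k - 1) * gderiv_theta j n)"
proof (induction k)
  case 0
  show ?case using gderiv_theta_of_real[of j 1] by simp
next
  case (Suc k)
  have "n ^ k * gderiv_theta j n = gderiv_theta j n * n ^ k"
    by (rule even_commute[OF has_parity_0_power[OF assms]])
  moreover have "n * (real k *\<^sub>R (n ^ (k - 1) * gderiv_theta j n)) = real k *\<^sub>R (n ^ k * gderiv_theta j n)"
    by (cases k) (simp_all add: mult.assoc)
  ultimately show ?case
    using assms by (simp add: gderiv_theta_mult Suc ginvol_eq[of 0] scaleR_add_left)
qed

lemma gderiv_theta_glift:
  assumes "has_parity 0 u"
  shows "gderiv_theta j (glift F u) = glift (deriv F) u * gderiv_theta j u"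
proof (rule grassmann_eqI)
  fix K :: "nat set" assume K: "finite K"
  let ?N = "card K" and ?d = "gderiv_theta j (gsoul u)"
  have d: "gderiv_theta j u = ?d" by (simp add: gsoul_def)
  \<comment> \<open>The derivative reads the coefficient at \<open>insert j K\<close>, which takes
    one Taylor order more than \<open>card K\<close>.\<close>
  have "gcoef (gderiv_theta j (glift F u)) K = gcoef (gderiv_theta j (gtaylor F (Suc ?N) u)) K"
    using K gcoef_glift[of "insert j K" "Suc ?N" F u]
    by (simp add: gcoef_gderiv_theta card_insert_if)
  also have "gderiv_theta j (gtaylor F (Suc ?N) u) = gtaylor (deriv F) ?N u * ?d"
    unfolding gtaylor_def gderiv_theta_sum gderiv_theta_linear
      gderiv_theta_even_power[OF has_parity_gsoul[OF assms]]
    by (subst even_power_deriv_sum)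
      (simp_all add: even_commute[OF has_parity_gsoul[OF assms]] funpow_swap1)
  finally show "gcoef (gderiv_theta j (glift F u)) K = gcoef (glift (deriv F) u * gderiv_theta j u) K"
    using gcoef_glift_mult[OF K order_refl] d by simp
qed

section \<open>Differentiable curves in the Grassmann algebra\<close>

text \<open>Derivatives are taken coefficientwise, so that ordinary real calculus applies and no
  topology on \<open>grassmann\<close> has to be chosen.\<close>

definition has_coef_derivative :: "(real \<Rightarrow> grassmann) \<Rightarrow> grassmann \<Rightarrow> real \<Rightarrow> bool" where
  "has_coef_derivative c d t \<longleftrightarrow>
     (\<forall>K. finite K \<longrightarrow> ((\<lambda>s. gcoef (c s) K) has_real_derivative gcoef d K) (at t))"

lemma has_coef_derivativeD:
  "has_coef_derivative c d t \<Longrightarrow> ((\<lambda>s. gcoef (c s) K) has_real_derivative gcoef d K) (at t)"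
  by (cases "finite K") (simp_all add: has_coef_derivative_def gcoef_infinite)

lemma has_coef_derivative_const: "has_coef_derivative (\<lambda>_. u) 0 t"
  by (simp add: has_coef_derivative_def)

lemma has_coef_derivative_add:
  "has_coef_derivative c d t \<Longrightarrow> has_coef_derivative c' d' t \<Longrightarrow>
    has_coef_derivative (\<lambda>s. c s + c' s) (d + d') t"
  by (simp add: has_coef_derivative_def DERIV_add)

lemma has_coef_derivative_diff:
  "has_coef_derivative c d t \<Longrightarrow> has_coef_derivative c' d' t \<Longrightarrow>
    has_coef_derivative (\<lambda>s. c s - c' s) (d - d') t"
  by (simp add: has_coef_derivative_def DERIV_diff)

lemma has_coef_derivative_scaleR:
  "(f has_real_derivative f') (at t) \<Longrightarrow> has_coef_derivative c d t \<Longrightarrow>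
    has_coef_derivative (\<lambda>s. f s *\<^sub>R c s) (f t *\<^sub>R d + f' *\<^sub>R c t) t"
  unfolding has_coef_derivative_def gcoef_scaleR gcoef_add by (intro allI impI DERIV_mult') auto

lemma has_coef_derivative_of_real:
  "(f has_real_derivative f') (at t) \<Longrightarrow> has_coef_derivative (\<lambda>s. of_real (f s)) (of_real f') t"
  by (simp add: has_coef_derivative_def gcoef_of_real)

lemma has_coef_derivative_sum:
  "(\<And>k. k \<in> A \<Longrightarrow> has_coef_derivative (c k) (d k) t) \<Longrightarrow>
    has_coef_derivative (\<lambda>s. \<Sum>k\<in>A. c k s) (\<Sum>k\<in>A. d k) t"
  by (simp add: has_coef_derivative_def DERIV_sum)

lemma has_coef_derivative_mult:
  assumes "has_coef_derivative c d t" "has_coef_derivative c' d' t"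
  shows "has_coef_derivative (\<lambda>s. c s * c' s) (d * c' t + c t * d') t"
  unfolding has_coef_derivative_def
proof (intro allI impI)
  fix K :: "nat set" assume K: "finite K"
  have "((\<lambda>s. gcoef (c s * c' s) K) has_real_derivative
      (\<Sum>I\<in>Pow K. shuffle_sign I (K - I) * (gcoef d I * gcoef (c' t) (K - I) + gcoef (c t) I * gcoef d' (K - I)))) (at t)"
    unfolding gcoef_mult[OF K] mult.assoc
    by (intro DERIV_sum DERIV_cmult)
      (auto intro!: derivative_eq_intros has_coef_derivativeD assms)
  also have "(\<Sum>I\<in>Pow K. shuffle_sign I (K - I) * (gcoef d I * gcoef (c' t) (K - I) + gcoef (c t) I * gcoef d' (K - I)))
      = gcoef (d * c' t + c t * d') K"
    by (simp add: gcoef_mult[OF K] algebra_simps sum.distrib)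
  finally show "((\<lambda>s. gcoef (c s * c' s) K) has_real_derivative gcoef (d * c' t + c t * d') K) (at t)" .
qed

lemma has_coef_derivative_power:
  assumes "has_coef_derivative c d t" "c t * d = d * c t"
  shows "has_coef_derivative (\<lambda>s. c s ^ k) (real k *\<^sub>R (c t ^ (k - 1) * d)) t"
proof (induction k)
  case 0
  show ?case using has_coef_derivative_const[of 1] by simp
next
  case (Suc k)
  have "c t * (real k *\<^sub>R (c t ^ (k - 1) * d)) = real k *\<^sub>R (c t ^ k * d)"
    by (cases k) (simp_all add: mult.assoc)
  moreover have "d * c t ^ k = c t ^ k * d"
    by (rule power_commuting_commutes[symmetric]) (rule assms(2))
  ultimately have "d * c t ^ k + c t * (real k *\<^sub>R (c t ^ (k - 1) * d)) = real (Suc k) *\<^sub>R (c t ^ (Suc k - 1) * d)"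
    by (simp add: scaleR_add_left)
  then show ?case using has_coef_derivative_mult[OF assms(1) Suc] by simp
qed

lemma has_coef_derivative_gbody:
  "has_coef_derivative c d t \<Longrightarrow> ((\<lambda>s. gbody (c s)) has_real_derivative gbody d) (at t)"
  by (simp add: gbody_def has_coef_derivativeD)

text \<open>Body and soul of the curve both move. The moving body differentiates the Taylor
  coefficients and gives the \<open>gbody d\<close> part of the product; the moving soul
  differentiates the powers and gives the \<open>gsoul d\<close> part.\<close>

lemma has_coef_derivative_glift:
  assumes c: "has_coef_derivative c d t" and even: "has_parity 0 (c t)"
    and F: "\<And>k. (deriv ^^ k) F differentiable at (gbody (c t))"
  shows "has_coef_derivative (\<lambda>s. glift F (c s)) (glift (deriv F) (c t) * d) t"
  unfolding has_coef_derivative_def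
proof (intro allI impI)
  fix K :: "nat set" assume K: "finite K"
  define N where "N = card K"
  let ?b = "gbody (c t)" and ?n = "gsoul (c t)"
  define a where "a k = (deriv ^^ k) F ?b" for k
  have n: "has_coef_derivative (\<lambda>s. gsoul (c s)) (gsoul d) t"
    unfolding gsoul_def
    by (intro has_coef_derivative_diff has_coef_derivative_of_real has_coef_derivative_gbody c)
  have comm: "?n * v = v * ?n" for v
    by (rule even_commute[OF has_parity_gsoul[OF even]])
  have "((deriv ^^ k) F has_real_derivative a (Suc k)) (at ?b)" for k
    using F[of k] by (simp add: a_def DERIV_deriv_iff_real_differentiable)
  then have coeff: "((\<lambda>s. (deriv ^^ k) F (gbody (c s)) / fact k) has_real_derivative
      a (Suc k) * gbody d / fact k) (at t)" for k
    by (intro DERIV_cdivide DERIV_chain2[OF _ has_coef_derivative_gbody[OF c]])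
  let ?D = "\<Sum>k\<le>N. (a k / fact k) *\<^sub>R (real k *\<^sub>R (?n ^ (k - 1) * gsoul d)) +
      (a (Suc k) * gbody d / fact k) *\<^sub>R ?n ^ k"
  have D: "has_coef_derivative (\<lambda>s. gtaylor F N (c s)) ?D t"
    unfolding gtaylor_def a_def
    by (intro has_coef_derivative_sum has_coef_derivative_scaleR has_coef_derivative_power n comm
        coeff[unfolded a_def])
  have D_eq: "gcoef ?D K = gcoef (gtaylor (deriv F) N (c t) * d) K"
  proof -
    have "(\<Sum>k\<le>N. (a (Suc k) * gbody d / fact k) *\<^sub>R ?n ^ k) = gtaylor (deriv F) N (c t) * of_real (gbody d)"
      by (simp add: gtaylor_def a_def sum_distrib_right of_real_def funpow_swap1 mult.commute scaleR_sum_right)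
    \<comment> \<open>At the fixed order \<open>N\<close> the differentiated powers stop one term
      short of the Taylor polynomial of \<open>deriv F\<close>; the missing term is subtracted here
      and shown next not to reach \<open>K\<close>.\<close>
    moreover have "(\<Sum>k\<le>N. (a k / fact k) *\<^sub>R (real k *\<^sub>R (?n ^ (k - 1) * gsoul d))) =
        gtaylor (deriv F) N (c t) * gsoul d
        - (a (Suc N) / fact (Suc N)) *\<^sub>R (real (Suc N) *\<^sub>R (?n ^ N * gsoul d))"
      using even_power_deriv_sum[OF comm[symmetric], where a = a and N = N and d = "gsoul d"]
      by (simp add: gtaylor_def a_def funpow_swap1 eq_diff_eq)
    \<comment> \<open>The power alone begins only in degree \<open>N\<close>, which is the size of
      \<open>K\<close>; the bodyless factor \<open>gsoul d\<close> pushes the product beyond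
      it.\<close>
    moreover have "gcoef (?n ^ N * gsoul d) K = 0"
    proof -
      have "?n ^ N * gsoul d = gsoul d * ?n ^ N"
        by (rule even_commute[OF has_parity_0_power[OF has_parity_gsoul[OF even]]])
      moreover have "gcoef (gsoul d * ?n ^ N) K = 0"
      proof -
        have "gcoef (gsoul d) I * gcoef (?n ^ N) (K - I) = 0" if "I \<subseteq> K" for I
        proof (cases "I = {}")
          case True
          then show ?thesis using gbody_gsoul[of d] by (simp add: gbody_def)
        next
          case False
          then have "K - I \<subset> K" using that by auto
          then have "card (K - I) < N" unfolding N_def by (rule psubset_card_mono[OF K])
          then show ?thesis using gcoef_soul_power_mult[of ?n "K - I" N 1] K by simp
        qed
        then show ?thesis by (simp add: gcoef_mult[OF K] mult.assoc sum.neutral)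
      qed
      ultimately show ?thesis by simp
    qed
    moreover have "d = of_real (gbody d) + gsoul d" by (simp add: gsoul_def)
    then have "gtaylor (deriv F) N (c t) * d =
        gtaylor (deriv F) N (c t) * of_real (gbody d) + gtaylor (deriv F) N (c t) * gsoul d"
      by (metis distrib_left)
    ultimately show ?thesis by (simp only: sum.distrib) simp
  qed
  have "((\<lambda>s. gcoef (gtaylor F N (c s)) K) has_real_derivative
      gcoef (gtaylor (deriv F) N (c t) * d) K) (at t)"
    using has_coef_derivativeD[OF D, of K] unfolding D_eq .
  then show "((\<lambda>s. gcoef (glift F (c s)) K) has_real_derivative gcoef (glift (deriv F) (c t) * d) K) (at t)"
    using K by (simp add: gcoef_glift[of K N] gcoef_glift_mult[of K N] N_def)
qed

section \<open>Exponential, logarithm and powers of even elements\<close>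

lemma real_differentiableI: "(F has_real_derivative D) (at b) \<Longrightarrow> F differentiable at b"
  by (auto simp: real_differentiable_def)

lemma real_differentiable_cong_ev:
  assumes "\<forall>\<^sub>F x in nhds b. F x = G x" "(G has_real_derivative D) (at b)"
  shows "F differentiable at b"
  by (rule real_differentiableI[of _ D], rule iffD2[OF DERIV_cong_ev[OF refl assms(1) refl] assms(2)])

definition smooth_at :: "real \<Rightarrow> (real \<Rightarrow> real) \<Rightarrow> bool" where
  "smooth_at b F \<longleftrightarrow> (\<forall>k. (deriv ^^ k) F differentiable at b)"

lemma smooth_at_deriv: "smooth_at b F \<Longrightarrow> smooth_at b (deriv F)"
  unfolding smooth_at_def by (metis comp_apply funpow_Suc_right)

lemma smooth_at_SucI:
  assumes "F differentiable at b" "smooth_at b (deriv F)" shows "smooth_at b F"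
  unfolding smooth_at_def
proof
  fix k show "(deriv ^^ k) F differentiable at b"
    using assms by (cases k) (auto simp: smooth_at_def funpow_swap1)
qed

lemma smooth_at_cong:
  assumes "\<forall>\<^sub>F x in nhds b. F x = G x" "smooth_at b G" shows "smooth_at b F"
  unfolding smooth_at_def
proof
  fix k
  have "\<forall>\<^sub>F x in nhds b. (deriv ^^ k) F x = (deriv ^^ k) G x"
  \<comment> \<open>Agreement near \<open>b\<close> is agreement near every point close to
    \<open>b\<close>, so the higher derivatives agree on a neighbourhood and not just at
    \<open>b\<close>.\<close>
  proof (rule eventually_mono)
    show "\<forall>\<^sub>F y in nhds b. \<forall>\<^sub>F x in nhds y. F x = G x"
      using assms(1) by (simp add: eventually_eventually)
  qed (rule higher_deriv_cong_ev, auto)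
  moreover have "((deriv ^^ k) G has_real_derivative deriv ((deriv ^^ k) G) b) (at b)"
    using assms(2) by (simp add: smooth_at_def DERIV_deriv_iff_real_differentiable)
  ultimately show "(deriv ^^ k) F differentiable at b"
    by (rule real_differentiable_cong_ev)
qed

lemma deriv_exp [simp]: "deriv exp = (exp :: real \<Rightarrow> real)"
  by (rule ext) (rule DERIV_imp_deriv[OF DERIV_exp])

lemma smooth_at_exp: "smooth_at b exp"
proof -
  have "(deriv ^^ k) exp = (exp :: real \<Rightarrow> real)" for k by (induction k) simp_all
  then show ?thesis 
    using real_differentiableI[OF DERIV_exp, of b] by (simp add: smooth_at_def)
qed

lemma eventually_nhds_pos: "0 < (b::real) \<Longrightarrow> \<forall>\<^sub>F x in nhds b. 0 < x"
  using eventually_nhds_in_open[of "{0<..}" b] by simp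

text \<open>The formula is proved at every positive point at once, because the next derivative needs
  it on a neighbourhood.\<close>

lemma higher_deriv_powr:
  "0 < x \<Longrightarrow> (deriv ^^ k) (\<lambda>x. x powr a) x = (\<Prod>i<k. a - real i) * x powr (a - real k)"
proof (induction k arbitrary: x)
  case (Suc k)
  have "\<forall>\<^sub>F y in nhds x. (deriv ^^ k) (\<lambda>x. x powr a) y = (\<Prod>i<k. a - real i) * y powr (a - real k)"
    by (rule eventually_mono[OF eventually_nhds_pos[OF Suc.prems] Suc.IH])
  then have "(deriv ^^ Suc k) (\<lambda>x. x powr a) x = deriv (\<lambda>y. (\<Prod>i<k. a - real i) * y powr (a - real k)) x"
    by (simp add: deriv_cong_ev)
  also have "\<dots> = (\<Prod>i<k. a - real i) * ((a - real k) * x powr (a - real k - 1))"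
    by (intro DERIV_imp_deriv DERIV_cmult has_real_derivative_powr Suc.prems)
  finally show ?case by (simp add: algebra_simps)
qed simp

lemma smooth_at_powr: assumes "0 < b" shows "smooth_at b (\<lambda>x. x powr a)"
  unfolding smooth_at_def
proof
  fix k
  have "\<forall>\<^sub>F y in nhds b. (deriv ^^ k) (\<lambda>x. x powr a) y = (\<Prod>i<k. a - real i) * y powr (a - real k)"
    by (rule eventually_mono[OF eventually_nhds_pos[OF assms]]) (rule higher_deriv_powr)
  moreover have "((\<lambda>y. (\<Prod>i<k. a - real i) * y powr (a - real k)) has_real_derivative
      (\<Prod>i<k. a - real i) * ((a - real k) * b powr (a - real k - 1))) (at b)"
    by (intro DERIV_cmult has_real_derivative_powr assms)
  ultimately show "(deriv ^^ k) (\<lambda>x. x powr a) differentiable at b"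
    by (rule real_differentiable_cong_ev)
qed

lemma eventually_inverse_powr: "0 < (b::real) \<Longrightarrow> \<forall>\<^sub>F x in nhds b. inverse x = x powr - 1"
proof (rule eventually_mono[OF eventually_nhds_pos])
  show "inverse x = x powr - 1" if "0 < x" for x :: real
    using powr_minus[of x 1] that by simp
qed

lemma eventually_sqrt_powr: "0 < (b::real) \<Longrightarrow> \<forall>\<^sub>F x in nhds b. sqrt x = x powr (1 / 2)"
  by (rule eventually_mono[OF eventually_nhds_pos]) (auto simp: powr_half_sqrt)

lemma eventually_deriv_ln: "0 < (b::real) \<Longrightarrow> \<forall>\<^sub>F x in nhds b. deriv ln x = inverse (x :: real)"
  by (rule eventually_mono[OF eventually_nhds_pos]) (auto intro!: DERIV_imp_deriv DERIV_ln)

lemma smooth_at_inverse: "0 < b \<Longrightarrow> smooth_at b inverse"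
  by (rule smooth_at_cong[OF eventually_inverse_powr smooth_at_powr])

lemma smooth_at_sqrt: "0 < b \<Longrightarrow> smooth_at b sqrt"
  by (rule smooth_at_cong[OF eventually_sqrt_powr smooth_at_powr])

lemma smooth_at_ln: "0 < b \<Longrightarrow> smooth_at b ln"
  by (rule smooth_at_SucI)
    (auto intro!: smooth_at_cong[OF eventually_deriv_ln smooth_at_inverse] real_differentiableI DERIV_ln)

text \<open>
  Identities between lifted functions are checked along the curve from the body of \<open>u\<close> to \<open>u\<close>.  Since
  the velocity \<open>n\<close> has no body, the equation below determines a coefficient of \<open>Q i\<close> from
  coefficients of lower degree.
\<close>

lemma soul_flow_zero:
  assumes n: "gbody n = 0" and init: "\<And>i. Q i 0 = 0"
    and flow: "\<And>i t. has_coef_derivative (Q i) ((r i *\<^sub>R Q (f i) t + s i *\<^sub>R Q (g i) t) * n) t"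
  shows "Q i t = 0"
proof (rule grassmann_eqI)
  fix K :: "nat set" assume "finite K"
  then have "\<forall>i t. gcoef (Q i t) K = 0"
  proof (induction K rule: finite_psubset_induct)
    case (psubset K)
    have "gcoef ((r i *\<^sub>R Q (f i) t + s i *\<^sub>R Q (g i) t) * n) K = 0" for i t
    proof -
      have "gcoef (r i *\<^sub>R Q (f i) t + s i *\<^sub>R Q (g i) t) I * gcoef n (K - I) = 0" if "I \<subseteq> K" for I
        using that psubset.IH[of I] n by (cases "I = K") (simp_all add: gbody_def psubset_eq)
      then show ?thesis by (simp add: gcoef_mult psubset.hyps mult.assoc sum.neutral del: gcoef_add)
    qed
    then have "\<forall>t. ((\<lambda>t. gcoef (Q i t) K) has_real_derivative 0) (at t)" for i
      using has_coef_derivativeD[OF flow, of i K] by simp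
    then have "gcoef (Q i t) K = gcoef (Q i 0) K" for i t
      by (rule DERIV_isconst_all)
    then show ?case by (simp add: init)
  qed
  then show "gcoef (Q i t) K = gcoef 0 K" by simp
qed

text \<open>Only the soul moves. The constant body keeps the curve where the lifted function is
  smooth, and at \<open>t = 0\<close> the point is real, so that the real identity supplies the
  initial value.\<close>

definition soul_line :: "grassmann \<Rightarrow> real \<Rightarrow> grassmann" where
  "soul_line u t = of_real (gbody u) + t *\<^sub>R gsoul u"

lemma soul_line_simps [simp]:
  "soul_line u 0 = of_real (gbody u)" "soul_line u 1 = u" "gbody (soul_line u t) = gbody u"
  by (simp_all add: soul_line_def gsoul_def)

lemma has_parity_soul_line: "has_parity 0 u \<Longrightarrow> has_parity 0 (soul_line u t)"
  by (simp add: soul_line_def has_parity_add has_parity_scaleR has_parity_gsoul has_parity_0_of_real)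

lemma has_coef_derivative_soul_line: "has_coef_derivative (soul_line u) (gsoul u) t"
  using has_coef_derivative_add[OF has_coef_derivative_const
      has_coef_derivative_scaleR[OF DERIV_ident has_coef_derivative_const]]
  by (simp add: soul_line_def[abs_def])

lemma gexp_scaleR_add:
  assumes "has_parity 0 u"
  shows "gexp (a *\<^sub>R u) * gexp (b *\<^sub>R u) = gexp ((a + b) *\<^sub>R u)"
proof -
  let ?n = "gsoul u" and ?E = "\<lambda>a t. gexp (a *\<^sub>R soul_line u t)"
  have E: "has_coef_derivative (?E a) (a *\<^sub>R (?E a t * ?n)) t" for a t
    using has_coef_derivative_glift[of "\<lambda>t. a *\<^sub>R soul_line u t" "a *\<^sub>R ?n" t exp]
      has_coef_derivative_scaleR[OF DERIV_const has_coef_derivative_soul_line, of a u t]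
    by (simp add: has_parity_scaleR has_parity_soul_line assms smooth_at_exp[unfolded smooth_at_def])
  have comm: "?E a t * (?n * ?E b t) = ?E a t * (?E b t * ?n)" for t
    by (simp add: even_commute[OF has_parity_gsoul[OF assms]])
  have const: "gexp (c *\<^sub>R of_real x) = of_real (exp (c * x))" for c x
    using glift_of_real[of exp "c * x"] by (simp add: scaleR_conv_of_real)
  \<comment> \<open>The difference solves the single linear equation
    \<open>Q' = (a + b) Q n\<close>, hence the index type \<open>unit\<close>.\<close>
  define Q where "Q i t = ?E a t * ?E b t - ?E (a + b) t" for i :: unit and t
  have "Q () 1 = 0"
  proof (rule soul_flow_zero[where Q = Q and n = ?n and r = "\<lambda>_. a + b" and s = "\<lambda>_. 0"])
    show "has_coef_derivative (Q i) (((a + b) *\<^sub>R Q (f i) t + 0 *\<^sub>R Q (g i) t) * ?n) t" for f g i t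
      using has_coef_derivative_diff[OF has_coef_derivative_mult[OF E[of a t] E[of b t]] E[of "a + b" t]]
      by (simp add: Q_def[abs_def] algebra_simps comm)
  qed (simp_all add: Q_def const exp_add distrib_right)
  then show ?thesis by (simp add: Q_def)
qed

lemma gexp_minus_mult: "has_parity 0 u \<Longrightarrow> gexp (- a *\<^sub>R u) * gexp (a *\<^sub>R u) = 1"
  using gexp_scaleR_add[of u "- a" a] glift_of_real[of exp 0] by simp

text \<open>On positive bodies, inverse, root and identity are the exponents -1, 1/2 and 1 of this
  family. It is closed under differentiation up to scalars, so that the laws of \<open>ginv\<close>
  and \<open>gsqrt\<close> become instances of \<open>gpow_add\<close>.\<close>

definition gpow :: "real \<Rightarrow> grassmann \<Rightarrow> grassmann" where
  "gpow a = glift (\<lambda>x. x powr a)"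

lemma gpow_of_real [simp]: "gpow a (of_real b) = of_real (b powr a)"
  by (simp add: gpow_def)

lemma glift_deriv_powr:
  assumes "0 < gbody u" shows "glift (deriv (\<lambda>x. x powr a)) u = a *\<^sub>R gpow (a - 1) u"
proof (rule grassmann_eqI)
  fix K :: "nat set" assume "finite K"
  have "(deriv ^^ k) (deriv (\<lambda>x. x powr a)) (gbody u) = a * (deriv ^^ k) (\<lambda>x. x powr (a - 1)) (gbody u)" for k
    using higher_deriv_powr[OF assms, of "Suc k" a] higher_deriv_powr[OF assms, of k "a - 1"]
    by (simp add: funpow_swap1 prod.lessThan_Suc_shift del: prod.lessThan_Suc) (simp add: algebra_simps)
  then show "gcoef (glift (deriv (\<lambda>x. x powr a)) u) K = gcoef (a *\<^sub>R gpow (a - 1) u) K"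
    by (simp add: gpow_def glift.rep_eq sum_distrib_left mult.assoc)
qed

lemma has_coef_derivative_gpow_soul_line:
  assumes "has_parity 0 u" "0 < gbody u"
  shows "has_coef_derivative (\<lambda>t. gpow a (soul_line u t)) (a *\<^sub>R (gpow (a - 1) (soul_line u t) * gsoul u)) t"
  using has_coef_derivative_glift[OF has_coef_derivative_soul_line has_parity_soul_line, OF assms(1),
      of "\<lambda>x. x powr a" t] assms
  by (simp add: smooth_at_powr[unfolded smooth_at_def] glift_deriv_powr gpow_def[of a])

lemma gpow_0:
  assumes "has_parity 0 u" "0 < gbody u" shows "gpow 0 u = 1"
proof -
  define Q where "Q i t = gpow 0 (soul_line u t) - 1" for i :: unit and t
  have "Q () 1 = 0"
  proof (rule soul_flow_zero[where Q = Q and n = "gsoul u" and r = "\<lambda>_. 0" and s = "\<lambda>_. 0"])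
    show "has_coef_derivative (Q i) ((0 *\<^sub>R Q (f i) t + 0 *\<^sub>R Q (g i) t) * gsoul u) t" for f g i t
      using has_coef_derivative_diff[OF has_coef_derivative_gpow_soul_line[OF assms, of 0 t]
          has_coef_derivative_const[of 1]]
      by (simp add: Q_def[abs_def])
  qed (use assms in \<open>simp_all add: Q_def\<close>)
  then show ?thesis by (simp add: Q_def)
qed

lemma gpow_1:
  assumes "has_parity 0 u" "0 < gbody u" shows "gpow 1 u = u"
proof -
  define Q where "Q i t = gpow 1 (soul_line u t) - soul_line u t" for i :: unit and t
  have "Q () 1 = 0"
  proof (rule soul_flow_zero[where Q = Q and n = "gsoul u" and r = "\<lambda>_. 0" and s = "\<lambda>_. 0"])
    show "has_coef_derivative (Q i) ((0 *\<^sub>R Q (f i) t + 0 *\<^sub>R Q (g i) t) * gsoul u) t" for f g i t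
      using has_coef_derivative_diff[OF has_coef_derivative_gpow_soul_line[OF assms, of 1 t]
          has_coef_derivative_soul_line[of u]] assms
      by (simp add: Q_def[abs_def] gpow_0 has_parity_soul_line)
  qed (use assms in \<open>simp_all add: Q_def\<close>)
  then show ?thesis by (simp add: Q_def)
qed

text \<open>Differentiating the product lowers one of the exponents, so the equation for
  \<open>(a, b)\<close> involves \<open>(a - 1, b)\<close> and \<open>(a, b - 1)\<close>. All pairs
  of exponents are therefore treated at once.\<close>

lemma gpow_add:
  assumes "has_parity 0 u" "0 < gbody u"
  shows "gpow a u * gpow b u = gpow (a + b) u"
proof -
  let ?n = "gsoul u" and ?P = "\<lambda>a t. gpow a (soul_line u t)"
  define Q where "Q i t = ?P (fst i) t * ?P (snd i) t - ?P (fst i + snd i) t" for i t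
  note P = has_coef_derivative_gpow_soul_line[OF assms]
  have comm: "?P a t * (?n * ?P b t) = ?P a t * (?P b t * ?n)" for a b t
    by (simp add: even_commute[OF has_parity_gsoul[OF assms(1)]])
  have "Q (a, b) 1 = 0"
  proof (rule soul_flow_zero[where Q = Q and n = ?n and r = fst and s = snd
        and f = "\<lambda>i. (fst i - 1, snd i)" and g = "\<lambda>i. (fst i, snd i - 1)"])
    show "has_coef_derivative (Q i) ((fst i *\<^sub>R Q (fst i - 1, snd i) t + snd i *\<^sub>R Q (fst i, snd i - 1) t) * ?n) t"
      for i t
      using has_coef_derivative_diff[OF has_coef_derivative_mult[OF P[of "fst i" t] P[of "snd i"]]
          P[of "fst i + snd i"]]
      by (simp add: Q_def[abs_def] algebra_simps comm)
  qed (use assms in \<open>simp_all add: Q_def powr_add\<close>)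
  then show ?thesis by (simp add: Q_def)
qed

lemma ginv_mult:
  assumes "has_parity 0 u" "0 < gbody u" shows "ginv u * u = 1"
  using gpow_add[OF assms, of "- 1" 1] glift_cong[OF eventually_inverse_powr[OF assms(2)]]
  by (simp add: gpow_0 gpow_1 gpow_def[of "- 1"] assms)

lemma ginv_eqI:
  assumes "has_parity 0 u" "0 < gbody u" "v * u = 1" shows "ginv u = v"
proof -
  have "u * ginv u = 1" using ginv_mult[OF assms(1,2)] even_commute[OF assms(1), of "ginv u"] by simp
  then have "v = v * (u * ginv u)" by simp
  also have "\<dots> = ginv u" by (simp add: assms(3) flip: mult.assoc)
  finally show ?thesis ..
qed

lemma gsqrt_square:
  assumes "has_parity 0 u" "0 < gbody u" shows "gsqrt u * gsqrt u = u"
  using gpow_add[OF assms, of "1 / 2" "1 / 2"] glift_cong[OF eventually_sqrt_powr[OF assms(2)]]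
  by (simp add: gpow_1 gpow_def[of "1 / 2"] assms)

text \<open>Instead of composing Taylor expansions, the composite is differentiated along the soul
  line: it has the same velocity as the line itself, and both start at the body of
  \<open>u\<close>.\<close>

lemma gln_gexp:
  assumes "has_parity 0 u" shows "gln (gexp u) = u"
proof -
  have d: "has_coef_derivative (\<lambda>t. gln (gexp (soul_line u t))) (gsoul u) t" for t
  proof -
    let ?e = "gexp (soul_line u t)"
    have "has_coef_derivative (\<lambda>t. gexp (soul_line u t)) (?e * gsoul u) t"
      using has_coef_derivative_glift[OF has_coef_derivative_soul_line has_parity_soul_line[OF assms], of exp]
      by (simp add: smooth_at_exp[unfolded smooth_at_def])
    then have "has_coef_derivative (\<lambda>t. gln (gexp (soul_line u t))) (glift (deriv ln) ?e * (?e * gsoul u)) t"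
      by (rule has_coef_derivative_glift)
        (simp_all add: has_parity_glift has_parity_soul_line assms smooth_at_ln[unfolded smooth_at_def])
    moreover have "glift (deriv ln) ?e * ?e = 1"
      using glift_cong[OF eventually_deriv_ln, of ?e] ginv_mult[of ?e]
      by (simp add: has_parity_glift has_parity_soul_line assms)
    ultimately show ?thesis by (simp flip: mult.assoc)
  qed
  define Q where "Q i t = gln (gexp (soul_line u t)) - soul_line u t" for i :: unit and t
  have "Q () 1 = 0"
  proof (rule soul_flow_zero[where Q = Q and n = "gsoul u" and r = "\<lambda>_. 0" and s = "\<lambda>_. 0"])
    show "has_coef_derivative (Q i) ((0 *\<^sub>R Q (f i) t + 0 *\<^sub>R Q (g i) t) * gsoul u) t" for f g i t
      using has_coef_derivative_diff[OF d has_coef_derivative_soul_line[of u]]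
      by (simp add: Q_def[abs_def])
  qed (simp_all add: Q_def)
  then show ?thesis by (simp add: Q_def)
qed

text \<open>Equal squares give \<open>(u - v) * (u + v) = 0\<close>, and the sum is invertible
  because its body is positive.\<close>

lemma even_sqrt_unique:
  assumes "has_parity 0 u" "has_parity 0 v" "0 < gbody u" "0 < gbody v" "u * u = v * v"
  shows "u = v"
proof -
  have "(u - v) * (u + v) = 0"
    using assms(5) even_commute[OF assms(1), of v] by (simp add: algebra_simps)
  moreover have "(u + v) * ginv (u + v) = 1"
    using ginv_mult[of "u + v"] even_commute[of "u + v" "ginv (u + v)"] assms
    by (simp add: has_parity_add)
  ultimately have "u - v = 0" by (metis mult.assoc mult.right_neutral mult_zero_left)
  then show ?thesis by simp
qed

text \<open>Both sides are even with positive body and have the same square. This relates the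
  half-densities \<open>\<rho>'^(1/2)\<close> and \<open>\<rho>^(1/2)\<close>.\<close>

lemma gsqrt_gexp_mult:
  assumes "has_parity 0 u" "has_parity 0 v" "0 < gbody v"
  shows "gsqrt (gexp u * v) = gexp ((1 / 2) *\<^sub>R u) * gsqrt v"
proof (rule even_sqrt_unique)
  let ?E = "gexp ((1 / 2) *\<^sub>R u)"
  have even: "has_parity 0 ?E" "has_parity 0 (gsqrt v)" "has_parity 0 (gexp u * v)"
    using has_parity_mult[of 0 "gexp u" 0 v] assms
    by (simp_all add: has_parity_glift has_parity_scaleR)
  then show "has_parity 0 (gsqrt (gexp u * v))" "has_parity 0 (?E * gsqrt v)"
    using has_parity_mult[of 0 ?E 0 "gsqrt v"] by (simp_all add: has_parity_glift)
  have "(?E * gsqrt v) * (?E * gsqrt v) = (?E * ?E) * (gsqrt v * gsqrt v)"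
    using even_commute[OF even(2), of ?E] by (simp flip: mult.assoc) (simp add: mult.assoc)
  also have "\<dots> = gexp u * v"
    using gexp_scaleR_add[OF assms(1), of "1 / 2" "1 / 2"] by (simp add: gsqrt_square assms)
  finally show "gsqrt (gexp u * v) * gsqrt (gexp u * v) = (?E * gsqrt v) * (?E * gsqrt v)"
    by (simp add: gsqrt_square even assms)
qed (use assms in simp_all)

section \<open>Derivations of superfunctions\<close>

lemma has_coef_derivative_cong_ev:
  assumes "\<forall>\<^sub>F s in nhds t. c s = c' s"
  shows "has_coef_derivative c d t \<longleftrightarrow> has_coef_derivative c' d t"
proof -
  have "\<forall>\<^sub>F s in nhds t. gcoef (c s) K = gcoef (c' s) K" for K
    using assms by (rule eventually_mono) simp
  from DERIV_cong_ev[OF refl this refl] show ?thesis by (simp add: has_coef_derivative_def)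
qed

lemma gcoef_even_deriv: "gcoef (even_deriv i f x) K = partial i (\<lambda>z. gcoef (f z) K) x"
  by (cases "finite K") (simp_all add: even_deriv.rep_eq gcoef_infinite partial_def)

lemma even_deriv_eqI:
  "has_coef_derivative (\<lambda>t. f (x(i := t))) d (x i) \<Longrightarrow> even_deriv i f x = d"
  by (rule grassmann_eqI)
    (auto simp: gcoef_even_deriv partial_def intro!: DERIV_imp_deriv has_coef_derivativeD)

lemma has_coef_derivative_gderiv_theta:
  "has_coef_derivative c d t \<Longrightarrow> has_coef_derivative (\<lambda>s. gderiv_theta j (c s)) (gderiv_theta j d) t"
  by (simp add: has_coef_derivative_def gcoef_gderiv_theta DERIV_cmult)

lemma has_coef_derivative_gpart:
  "has_coef_derivative c d t \<Longrightarrow> has_coef_derivative (\<lambda>s. gpart \<epsilon> (c s)) (gpart \<epsilon> d) t"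
  by (simp add: has_coef_derivative_def gcoef_gpart)

lemma minus_one_power_mult: "(- 1) ^ n * u = (- 1) ^ n *\<^sub>R (u :: grassmann)"
  by (cases "even n") simp_all

lemma eventually_coordinate_line:
  assumes V: "openin (Euclidean_space p) V" and x: "x \<in> V" "i < p"
  shows "\<forall>\<^sub>F t in nhds (x i). x(i := t) \<in> V"
proof -
  have "x \<in> topspace (Euclidean_space p)" using openin_subset[OF V] x by auto
  then have "continuous_map euclideanreal (Euclidean_space p) (\<lambda>t. x(i := t))"
    using x(2) unfolding Euclidean_space_def continuous_map_in_subtopology continuous_map_componentwise_UNIV
    by (auto simp: fun_upd_def)
  from openin_continuous_map_preimage[OF this V] have "open {t. x(i := t) \<in> V}" by simp
  from eventually_nhds_in_open[OF this, of "x i"] show ?thesis using x by simp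
qed

text \<open>
  Only derivatives along coordinate lines matter below, so \<open>V\<close> need only contain a piece of each
  coordinate line through its points.
\<close>

locale coordinate_domain =
  fixes p :: nat and V :: "(nat \<Rightarrow> real) set"
  assumes coordinate_line: "x \<in> V \<Longrightarrow> i < p \<Longrightarrow> \<forall>\<^sub>F t in nhds (x i). x(i := t) \<in> V"
begin

text \<open>Smoothness with a counter: superfunctions have every order, the Laplacian consumes two,
  and the closure rules for sums, products and lifts go by induction on the count.\<close>

primrec cdiff :: "nat \<Rightarrow> superfun \<Rightarrow> bool" where
  "cdiff 0 f \<longleftrightarrow> True"
| "cdiff (Suc n) f \<longleftrightarrow>
    (\<forall>i<p. \<forall>x\<in>V. has_coef_derivative (\<lambda>t. f (x(i := t))) (even_deriv i f x) (x i)) \<and>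
    (\<forall>i<p. cdiff n (even_deriv i f))"

lemma cdiffD:
  "cdiff (Suc n) f \<Longrightarrow> i < p \<Longrightarrow> x \<in> V \<Longrightarrow>
    has_coef_derivative (\<lambda>t. f (x(i := t))) (even_deriv i f x) (x i)"
  by simp

lemma cdiff_SucD: "cdiff (Suc n) f \<Longrightarrow> cdiff n f"
  by (induction n arbitrary: f) simp_all

lemma eventually_line_cong:
  assumes "\<And>x. x \<in> V \<Longrightarrow> f x = g x" "x \<in> V" "i < p"
  shows "\<forall>\<^sub>F t in nhds (x i). f (x(i := t)) = g (x(i := t))"
  by (rule eventually_mono[OF coordinate_line[OF assms(2,3)] assms(1)])

lemma even_deriv_cong:
  assumes "\<And>x. x \<in> V \<Longrightarrow> f x = g x" "x \<in> V" "i < p"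
  shows "even_deriv i f x = even_deriv i g x"
proof (rule grassmann_eqI)
  fix K
  show "gcoef (even_deriv i f x) K = gcoef (even_deriv i g x) K"
    unfolding gcoef_even_deriv partial_def
    by (rule deriv_cong_ev[OF eventually_line_cong refl]) (use assms in auto)
qed

lemma cdiff_cong:
  assumes "cdiff n f" "\<And>x. x \<in> V \<Longrightarrow> f x = g x"
  shows "cdiff n g"
  using assms
proof (induction n arbitrary: f g)
  case (Suc n)
  have eq: "even_deriv i f x = even_deriv i g x" if "x \<in> V" "i < p" for i x
    using even_deriv_cong[OF Suc.prems(2) that] .
  have "has_coef_derivative (\<lambda>t. g (x(i := t))) (even_deriv i g x) (x i)" if "i < p" "x \<in> V" for i x
  proof -
    have ev: "\<forall>\<^sub>F t in nhds (x i). f (x(i := t)) = g (x(i := t))"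
      by (rule eventually_line_cong) (use Suc.prems that in auto)
    from cdiffD[OF Suc.prems(1) that] show ?thesis
      unfolding has_coef_derivative_cong_ev[OF ev] eq[OF that(2,1)] .
  qed
  moreover have "cdiff n (even_deriv i g)" if "i < p" for i
    by (rule Suc.IH[of "even_deriv i f"]) (use Suc.prems that eq in auto)
  ultimately show ?case by simp
qed simp

text \<open>A closure rule may name its derivative by a formula; that \<open>even_deriv\<close>
  agrees with it only on \<open>V\<close> does no harm, by \<open>cdiff_cong\<close>.\<close>

lemma cdiff_SucI:
  assumes d: "\<And>i x. i < p \<Longrightarrow> x \<in> V \<Longrightarrow> has_coef_derivative (\<lambda>t. f (x(i := t))) (f' i x) (x i)"
    and f': "\<And>i. i < p \<Longrightarrow> cdiff n (f' i)"
  shows "cdiff (Suc n) f"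
proof -
  have eq: "even_deriv i f x = f' i x" if "i < p" "x \<in> V" for i x
    using d[OF that] by (rule even_deriv_eqI)
  then have "cdiff n (even_deriv i f)" if "i < p" for i
    by (intro cdiff_cong[OF f'[OF that]]) (simp add: that)
  then show ?thesis using d eq by simp
qed

lemma superfunction_on_cdiff:
  assumes "superfunction_on p q V f" shows "cdiff n f"
proof -
  \<comment> \<open>The induction keeps only the differentiability of iterated partial derivatives,
    a property that \<open>even_deriv j f\<close> inherits.\<close>
  have "cdiff n f" if "\<And>K is i x. set is \<subseteq> {..<p} \<Longrightarrow> i < p \<Longrightarrow> x \<in> V \<Longrightarrow>
      (\<lambda>t. partials is (\<lambda>x. gcoef (f x) K) (x(i := t))) differentiable at (x i)" for f
    using that
  proof (induction n arbitrary: f)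
    case (Suc n)
    have "has_coef_derivative (\<lambda>t. f (x(i := t))) (even_deriv i f x) (x i)" if "i < p" "x \<in> V" for i x
      using Suc.prems[of "[]" i x] that
      by (simp add: has_coef_derivative_def gcoef_even_deriv partial_def DERIV_deriv_iff_real_differentiable
        del: fun_upd_apply)
    moreover have "cdiff n (even_deriv j f)" if "j < p" for j
    proof (rule Suc.IH)
      fix K "is" i x assume *: "set is \<subseteq> {..<p}" "i < p" "x \<in> V"
      \<comment> \<open>The head of the list is differentiated last, so the derivative in direction
        \<open>j\<close>, which is taken first, goes to the end.\<close>
      have "partials is (partial j g) = partials (is @ [j]) g" for g
        by (induction "is") simp_all
      then show "(\<lambda>t. partials is (\<lambda>x. gcoef (even_deriv j f x) K) (x(i := t))) differentiable at (x i)"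
        using Suc.prems[of "is @ [j]" i x K] * that by (simp add: gcoef_even_deriv[abs_def] del: fun_upd_apply)
    qed
    ultimately show ?case by simp
  qed simp
  then show ?thesis using assms by (simp add: superfunction_on_def smooth_on_def)
qed

lemma cdiff_add: "cdiff n f \<Longrightarrow> cdiff n g \<Longrightarrow> cdiff n (\<lambda>x. f x + g x)"
proof (induction n arbitrary: f g)
  case (Suc n)
  show ?case
    by (rule cdiff_SucI[where f' = "\<lambda>i x. even_deriv i f x + even_deriv i g x"])
      (use Suc in \<open>auto simp del: fun_upd_apply intro: has_coef_derivative_add\<close>)
qed simp

lemma cdiff_sum: "(\<And>k. k \<in> A \<Longrightarrow> cdiff n (f k)) \<Longrightarrow> cdiff n (\<lambda>x. \<Sum>k\<in>A. f k x)"
proof (induction n arbitrary: f)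
  case (Suc n)
  show ?case
    by (rule cdiff_SucI[where f' = "\<lambda>i x. \<Sum>k\<in>A. even_deriv i (f k) x"])
      (use Suc in \<open>auto simp del: fun_upd_apply intro: has_coef_derivative_sum\<close>)
qed simp

lemma cdiff_scaleR: "cdiff n f \<Longrightarrow> cdiff n (\<lambda>x. c *\<^sub>R f x)"
proof (induction n arbitrary: f)
  case (Suc n)
  show ?case
    by (rule cdiff_SucI[where f' = "\<lambda>i x. c *\<^sub>R even_deriv i f x"])
      (use Suc has_coef_derivative_scaleR[OF DERIV_const, where t = t for t] in \<open>auto simp del: fun_upd_apply\<close>)
qed simp

lemma cdiff_gderiv_theta: "cdiff n f \<Longrightarrow> cdiff n (\<lambda>x. gderiv_theta j (f x))"
proof (induction n arbitrary: f)
  case (Suc n)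
  show ?case
    by (rule cdiff_SucI[where f' = "\<lambda>i x. gderiv_theta j (even_deriv i f x)"])
      (use Suc in \<open>auto simp del: fun_upd_apply intro: has_coef_derivative_gderiv_theta\<close>)
qed simp

lemma cdiff_gpart: "cdiff n f \<Longrightarrow> cdiff n (\<lambda>x. gpart \<epsilon> (f x))"
proof (induction n arbitrary: f)
  case (Suc n)
  show ?case
    by (rule cdiff_SucI[where f' = "\<lambda>i x. gpart \<epsilon> (even_deriv i f x)"])
      (use Suc in \<open>auto simp del: fun_upd_apply intro: has_coef_derivative_gpart\<close>)
qed simp

lemma has_coef_derivative_line_mult:
  assumes "cdiff 1 f" "cdiff 1 g" "i < p" "x \<in> V"
  shows "has_coef_derivative (\<lambda>t. f (x(i := t)) * g (x(i := t)))
    (even_deriv i f x * g x + f x * even_deriv i g x) (x i)"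
  using has_coef_derivative_mult[of "\<lambda>t. f (x(i := t))" _ "x i" "\<lambda>t. g (x(i := t))"] assms by simp

lemma cdiff_mult: "cdiff n f \<Longrightarrow> cdiff n g \<Longrightarrow> cdiff n (\<lambda>x. f x * g x)"
proof (induction n arbitrary: f g)
  case (Suc n)
  show ?case
  proof (rule cdiff_SucI[where f' = "\<lambda>i x. even_deriv i f x * g x + f x * even_deriv i g x"])
    show "cdiff n (\<lambda>x. even_deriv i f x * g x + f x * even_deriv i g x)" if "i < p" for i
      using Suc.prems cdiff_SucD[OF Suc.prems(1)] cdiff_SucD[OF Suc.prems(2)] that
      by (intro cdiff_add Suc.IH) auto
  qed (use Suc.prems in \<open>auto simp del: fun_upd_apply intro!: has_coef_derivative_line_mult\<close>)
qed simp

lemma has_coef_derivative_line_glift: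
  assumes "cdiff 1 f" "has_parity 0 (f x)" "smooth_at (gbody (f x)) F" "i < p" "x \<in> V"
  shows "has_coef_derivative (\<lambda>t. glift F (f (x(i := t)))) (glift (deriv F) (f x) * even_deriv i f x) (x i)"
  using has_coef_derivative_glift[of "\<lambda>t. f (x(i := t))" _ "x i" F] assms by (simp add: smooth_at_def)

text \<open>The chain rule replaces \<open>F\<close> by \<open>deriv F\<close>, so the induction
  runs over all \<open>F\<close> simultaneously.\<close>

lemma cdiff_glift:
  assumes "cdiff n f" "\<And>x. x \<in> V \<Longrightarrow> has_parity 0 (f x)" "\<And>x. x \<in> V \<Longrightarrow> smooth_at (gbody (f x)) F"
  shows "cdiff n (\<lambda>x. glift F (f x))"
  using assms(1,3)
proof (induction n arbitrary: F)
  case (Suc n)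
  show ?case
  proof (rule cdiff_SucI[where f' = "\<lambda>i x. glift (deriv F) (f x) * even_deriv i f x"])
    show "cdiff n (\<lambda>x. glift (deriv F) (f x) * even_deriv i f x)" if "i < p" for i
      using Suc cdiff_SucD[OF Suc.prems(1)] that by (intro cdiff_mult Suc.IH) (auto intro: smooth_at_deriv)
  qed (use Suc.prems assms(2) in \<open>auto simp del: fun_upd_apply intro!: has_coef_derivative_line_glift\<close>)
qed simp

section \<open>Calculus of the partial derivatives in even and odd directions\<close>

lemma cdiff_pd: "cdiff (Suc n) f \<Longrightarrow> cdiff n (pd p a f)"
  using cdiff_gderiv_theta[OF cdiff_SucD, of n f "a - p"] by (cases "a < p") (simp_all add: pd_def)

lemma pd_cong:
  assumes "\<And>x. x \<in> V \<Longrightarrow> f x = g x" "x \<in> V" shows "pd p a f x = pd p a g x"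
  using even_deriv_cong[of f g x a, OF assms] assms(1)[OF assms(2)] by (simp add: pd_def)

lemma pd_add:
  "cdiff 1 f \<Longrightarrow> cdiff 1 g \<Longrightarrow> x \<in> V \<Longrightarrow> pd p a (\<lambda>x. f x + g x) x = pd p a f x + pd p a g x"
  by (auto simp: pd_def simp del: fun_upd_apply intro!: even_deriv_eqI has_coef_derivative_add)

lemma pd_diff:
  "cdiff 1 f \<Longrightarrow> cdiff 1 g \<Longrightarrow> x \<in> V \<Longrightarrow> pd p a (\<lambda>x. f x - g x) x = pd p a f x - pd p a g x"
  by (auto simp: pd_def simp del: fun_upd_apply intro!: even_deriv_eqI has_coef_derivative_diff)

lemma pd_sum:
  "(\<And>k. k \<in> A \<Longrightarrow> cdiff 1 (f k)) \<Longrightarrow> x \<in> V \<Longrightarrow>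
    pd p a (\<lambda>x. \<Sum>k\<in>A. f k x) x = (\<Sum>k\<in>A. pd p a (f k) x)"
  by (auto simp: pd_def gderiv_theta_sum simp del: fun_upd_apply intro!: even_deriv_eqI has_coef_derivative_sum)

lemma pd_scaleR:
  assumes "cdiff 1 f" "x \<in> V" shows "pd p a (\<lambda>x. c *\<^sub>R f x) x = c *\<^sub>R pd p a f x"
  using has_coef_derivative_scaleR[OF DERIV_const, of "\<lambda>t. f (x(a := t))" _ "x a" c] assms
  by (auto simp: pd_def simp del: fun_upd_apply intro!: even_deriv_eqI)

lemma pd_mult:
  assumes "cdiff 1 f" "cdiff 1 g" "x \<in> V" "has_parity \<epsilon> (f x)"
  shows "pd p a (\<lambda>x. f x * g x) x = pd p a f x * g x + (- 1) ^ (cpar p a * \<epsilon>) *\<^sub>R (f x * pd p a g x)"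
proof (cases "a < p")
  case True
  have "even_deriv a (\<lambda>x. f x * g x) x = even_deriv a f x * g x + f x * even_deriv a g x"
    by (intro even_deriv_eqI has_coef_derivative_line_mult assms True)
  then show ?thesis using True by (simp add: pd_def cpar_def)
next
  case False
  then show ?thesis by (simp add: pd_def cpar_def gderiv_theta_mult ginvol_eq[OF assms(4)])
qed

lemma pd_glift:
  assumes "cdiff 1 f" "has_parity 0 (f x)" "smooth_at (gbody (f x)) F" "x \<in> V"
  shows "pd p a (\<lambda>x. glift F (f x)) x = glift (deriv F) (f x) * pd p a f x"
proof (cases "a < p")
  case True
  have "even_deriv a (\<lambda>x. glift F (f x)) x = glift (deriv F) (f x) * even_deriv a f x"
    by (intro even_deriv_eqI has_coef_derivative_line_glift assms True)
  then show ?thesis using True by (simp add: pd_def)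
next
  case False
  then show ?thesis by (simp add: pd_def gderiv_theta_glift assms)
qed

lemma has_parity_pd:
  assumes "\<And>x. x \<in> V \<Longrightarrow> has_parity \<epsilon> (f x)" "x \<in> V"
  shows "has_parity (cpar p a + \<epsilon>) (pd p a f x)"
proof (cases "a < p")
  case True
  have "gcoef (even_deriv a f x) K = 0" if "finite K" "card K mod 2 \<noteq> \<epsilon> mod 2" for K
  proof -
    have "gcoef (f x) K = 0" if "x \<in> V" for x
      using assms(1)[OF that] \<open>finite K\<close> \<open>card K mod 2 \<noteq> \<epsilon> mod 2\<close> by (auto simp: has_parity_iff)
    then have "deriv (\<lambda>t. gcoef (f (x(a := t))) K) (x a) = deriv (\<lambda>_. 0) (x a)"
      by (intro deriv_cong_ev eventually_line_cong) (use assms True in auto)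
    then show ?thesis by (simp add: gcoef_even_deriv partial_def)
  qed
  then show ?thesis using True by (auto simp: has_parity_iff pd_def cpar_def)
next
  case False
  then show ?thesis
    using has_parity_gderiv_theta[OF assms(1)[OF assms(2)]] by (simp add: pd_def cpar_def)
qed

end

section \<open>The odd Laplacian in a chart\<close>

locale odd_poisson_chart = coordinate_domain +
  fixes q :: nat and S :: "nat \<Rightarrow> nat \<Rightarrow> superfun"
  assumes S_superfunction: "a < p + q \<Longrightarrow> b < p + q \<Longrightarrow> superfunction_on p q V (S a b)"
    and S_parity: "a < p + q \<Longrightarrow> b < p + q \<Longrightarrow> x \<in> V \<Longrightarrow> has_parity (cpar p a + cpar p b + 1) (S a b x)"
    and S_symmetric: "a < p + q \<Longrightarrow> b < p + q \<Longrightarrow> x \<in> V \<Longrightarrow>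
      S a b x = (- 1) ^ (cpar p a * cpar p b) * S b a x"
begin

definition volume_coeff :: "superfun \<Rightarrow> bool" where
  "volume_coeff \<rho> \<longleftrightarrow> (\<forall>n. cdiff n \<rho>) \<and> (\<forall>x\<in>V. has_parity 0 (\<rho> x) \<and> 0 < gbody (\<rho> x))"

text \<open>This is \<rho> times the Laplacian of \<open>f\<close>, free of the inverse of \<rho>
  and of the splitting of \<open>f\<close> by parity.\<close>

definition divgrad :: "superfun \<Rightarrow> superfun \<Rightarrow> superfun" where
  "divgrad \<rho> f x = (\<Sum>a<p + q. \<Sum>b<p + q. pd p a (\<lambda>x. \<rho> x * S a b x * pd p b f x) x)"

definition chart_laplace :: "superfun \<Rightarrow> superfun \<Rightarrow> superfun" where
  "chart_laplace \<rho> f x =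
    (\<Sum>\<epsilon><2. super_div p q \<rho> (\<epsilon> + 1) (ham_vf p q S \<epsilon> (\<lambda>x. gpart \<epsilon> (f x))) x)"

lemma cdiff_S: "a < p + q \<Longrightarrow> b < p + q \<Longrightarrow> cdiff n (S a b)"
  by (rule superfunction_on_cdiff[OF S_superfunction])

lemma volume_coeffD:
  assumes "volume_coeff \<rho>"
  shows "cdiff n \<rho>" "x \<in> V \<Longrightarrow> has_parity 0 (\<rho> x)" "x \<in> V \<Longrightarrow> 0 < gbody (\<rho> x)"
  using assms by (auto simp: volume_coeff_def)

lemma cdiff_flux:
  assumes "volume_coeff \<rho>" "cdiff (Suc n) f" "a < p + q" "b < p + q"
  shows "cdiff n (\<lambda>x. \<rho> x * S a b x * pd p b f x)"
  by (intro cdiff_mult cdiff_pd volume_coeffD cdiff_S assms)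

text \<open>For a component of parity \<epsilon>, the Hamiltonian field carries the sign with
  exponent a \<epsilon> and the divergence the one with exponent a (\<epsilon> + 2), where a stands
  for the parity of the coordinate. They cancel, and the two components can be added up
  again.\<close>

lemma chart_laplace_eq:
  assumes \<rho>: "volume_coeff \<rho>" and f: "cdiff 2 f" and x: "x \<in> V"
  shows "chart_laplace \<rho> f x = ginv (\<rho> x) * divgrad \<rho> f x"
proof -
  have part: "cdiff (Suc 1) (\<lambda>x. gpart \<epsilon> (f x))" for \<epsilon>
    using cdiff_gpart[OF f] by (simp only: numeral_2_eq_2 One_nat_def)
  have part1: "cdiff 1 (\<lambda>x. gpart \<epsilon> (f x))" for \<epsilon>
    using cdiff_SucD[OF part] .
  have super_div_eq: "super_div p q \<rho> (\<epsilon> + 1) (ham_vf p q S \<epsilon> (\<lambda>x. gpart \<epsilon> (f x))) x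
      = ginv (\<rho> x) * divgrad \<rho> (\<lambda>x. gpart \<epsilon> (f x)) x" for \<epsilon>
  proof -
    have "(- 1) ^ (cpar p a * (\<epsilon> + 1 + 1)) * pd p a (\<lambda>x. \<rho> x * ham_vf p q S \<epsilon> (\<lambda>x. gpart \<epsilon> (f x)) a x) x
        = (\<Sum>b<p + q. pd p a (\<lambda>x. \<rho> x * S a b x * pd p b (\<lambda>x. gpart \<epsilon> (f x)) x) x)" if a: "a < p + q" for a
    proof -
      let ?c = "(- 1) ^ (cpar p a * \<epsilon>) :: real"
      have flux: "cdiff 1 (\<lambda>x. \<rho> x * S a b x * pd p b (\<lambda>x. gpart \<epsilon> (f x)) x)" if "b < p + q" for b
        using cdiff_flux[OF \<rho> part a that] .
      have "(\<lambda>x. \<rho> x * ham_vf p q S \<epsilon> (\<lambda>x. gpart \<epsilon> (f x)) a x) =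
          (\<lambda>x. ?c *\<^sub>R (\<Sum>b<p + q. \<rho> x * S a b x * pd p b (\<lambda>x. gpart \<epsilon> (f x)) x))"
        by (simp add: ham_vf_def minus_one_power_mult mult.assoc sum_distrib_left scaleR_sum_right)
      then have "pd p a (\<lambda>x. \<rho> x * ham_vf p q S \<epsilon> (\<lambda>x. gpart \<epsilon> (f x)) a x) x =
          ?c *\<^sub>R (\<Sum>b<p + q. pd p a (\<lambda>x. \<rho> x * S a b x * pd p b (\<lambda>x. gpart \<epsilon> (f x)) x) x)"
        using pd_scaleR[OF cdiff_sum[where A = "{..<p + q}", OF flux] x]
          pd_sum[where A = "{..<p + q}", OF flux x] by (simp only: lessThan_iff)
      moreover have "?c * (- 1) ^ (cpar p a * (\<epsilon> + 1 + 1)) = 1"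
        by (simp flip: power_add) (auto simp: minus_one_power_iff)
      ultimately show ?thesis by (simp add: minus_one_power_mult)
    qed
    then show ?thesis by (simp add: super_div_def divgrad_def)
  qed
  have "pd p a (\<lambda>x. \<rho> x * S a b x * pd p b f x) x =
      pd p a (\<lambda>x. \<rho> x * S a b x * pd p b (\<lambda>x. gpart 0 (f x)) x) x +
      pd p a (\<lambda>x. \<rho> x * S a b x * pd p b (\<lambda>x. gpart 1 (f x)) x) x"
    if ab: "a < p + q" "b < p + q" for a b
  proof -
    have "pd p b f y = pd p b (\<lambda>x. gpart 0 (f x)) y + pd p b (\<lambda>x. gpart 1 (f x)) y" if "y \<in> V" for y
      using pd_add[OF part1[of 0] part1[of 1] that, of b] by (simp only: gpart_0_add_1)
    then have "pd p a (\<lambda>x. \<rho> x * S a b x * pd p b f x) x =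
        pd p a (\<lambda>x. \<rho> x * S a b x * pd p b (\<lambda>x. gpart 0 (f x)) x +
          \<rho> x * S a b x * pd p b (\<lambda>x. gpart 1 (f x)) x) x"
      by (intro pd_cong x) (simp add: distrib_left)
    then show ?thesis using pd_add[OF cdiff_flux[OF \<rho> part ab] cdiff_flux[OF \<rho> part ab] x] by simp
  qed
  then have "divgrad \<rho> f x = divgrad \<rho> (\<lambda>x. gpart 0 (f x)) x + divgrad \<rho> (\<lambda>x. gpart 1 (f x)) x"
    by (simp add: divgrad_def sum.distrib)
  then show ?thesis
    unfolding chart_laplace_def super_div_eq
    by (simp add: numeral_2_eq_2 distrib_left)
qed

lemma divgrad_cong:
  assumes "\<And>x. x \<in> V \<Longrightarrow> \<rho> x = \<rho>' x" "\<And>x. x \<in> V \<Longrightarrow> f x = g x" "x \<in> V"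
  shows "divgrad \<rho> f x = divgrad \<rho>' g x"
  unfolding divgrad_def
  by (intro sum.cong refl pd_cong arg_cong2[where f = "(*)"] assms)

text \<open>Smoothness is asked of \<open>f\<close> and passes to \<open>g\<close>. This is how the
  logarithm inside \<open>master_H\<close> is replaced by \<sigma>.\<close>

lemma chart_laplace_cong:
  assumes \<rho>: "volume_coeff \<rho>" and f: "cdiff 2 f" and eq: "\<And>x. x \<in> V \<Longrightarrow> f x = g x" and x: "x \<in> V"
  shows "chart_laplace \<rho> g x = chart_laplace \<rho> f x"
  using chart_laplace_eq[OF \<rho> f x] chart_laplace_eq[OF \<rho> cdiff_cong[OF f eq] x] divgrad_cong[OF refl eq x]
  by simp

text \<open>The symmetry of \<open>S\<close> makes the two cross terms in the product rule for the Laplacian coincide.\<close>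

lemma S_contract_swap:
  assumes x: "x \<in> V" and r: "has_parity 0 r"
    and e: "\<And>a. a < p + q \<Longrightarrow> has_parity (cpar p a) (e a)"
  shows "(\<Sum>a<p + q. \<Sum>b<p + q. e a * (r * S a b x * h b)) = (\<Sum>a<p + q. \<Sum>b<p + q. r * S a b x * e b * h a)"
proof -
  have "e a * (r * S a b x * h b) = r * S b a x * e a * h b" if ab: "a < p + q" "b < p + q" for a b
  proof -
    \<comment> \<open>With a and b for the parities, a (a + 1) is even, so the exponent reduces to a
      b; the symmetry of \<open>S\<close> contributes the same sign, and the two cancel.\<close>
    have "e a * S a b x = (- 1) ^ (cpar p a * (cpar p a + cpar p b + 1)) *\<^sub>R (S a b x * e a)"
      by (rule supercommute[OF e S_parity]) (use ab x in auto)
    also have "S a b x = (- 1) ^ (cpar p a * cpar p b) *\<^sub>R S b a x"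
      using S_symmetric[OF ab x] by (simp only: minus_one_power_mult)
    also have "(- 1) ^ (cpar p a * (cpar p a + cpar p b + 1)) *\<^sub>R ((- 1) ^ (cpar p a * cpar p b) *\<^sub>R S b a x * e a)
        = S b a x * e a"
      by (simp add: cpar_def)
    finally have "e a * S a b x = S b a x * e a" 
      using S_symmetric[OF ab x] by (simp only: minus_one_power_mult)
    moreover have "e a * (r * S a b x * h b) = r * (e a * S a b x) * h b"
      by (simp add: even_commute[OF r, of "e a", symmetric] flip: mult.assoc)
    ultimately show ?thesis by (simp add: mult.assoc)
  qed
  then have "(\<Sum>a<p + q. \<Sum>b<p + q. e a * (r * S a b x * h b)) = (\<Sum>a<p + q. \<Sum>b<p + q. r * S b a x * e a * h b)"
    by simp
  also have "\<dots> = (\<Sum>a<p + q. \<Sum>b<p + q. r * S a b x * e b * h a)"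
    by (rule sum.swap)
  finally show ?thesis .
qed

text \<open>One of the two factors \<open>E\<close> turns the derivative of \<open>v\<close> into
  derivatives of \<open>u\<close> and \<open>E\<close>; the other stays in front of the flux of
  \<open>u\<close> or merges with \<open>v\<close> into \<open>u\<close>. The cross terms left by
  the outer derivative are kept as one bracket until the double sum is formed.\<close>

lemma divgrad_conjugate:
  assumes \<rho>: "volume_coeff \<rho>" and E: "cdiff 2 E" "\<And>x. x \<in> V \<Longrightarrow> has_parity 0 (E x)"
    and v: "cdiff 2 v" and x: "x \<in> V"
  defines "u \<equiv> \<lambda>x. E x * v x"
  shows "divgrad (\<lambda>x. E x * E x * \<rho> x) v x = E x * divgrad \<rho> u x - divgrad \<rho> E x * u x"
proof -
  have u: "cdiff 2 u" unfolding u_def by (intro cdiff_mult E v)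
  note two = numeral_2_eq_2 One_nat_def
  have c1: "cdiff 1 E" "cdiff 1 v" "cdiff 1 u"
    using cdiff_SucD[of 1] E(1) u v by (simp_all only: two)
  let ?W = "\<lambda>a b x. \<rho> x * S a b x"
  have expand: "pd p a (\<lambda>x. (E x * E x * \<rho> x) * S a b x * pd p b v x) x =
      E x * pd p a (\<lambda>x. ?W a b x * pd p b u x) x - pd p a (\<lambda>x. ?W a b x * pd p b E x) x * u x
      + (pd p a E x * (?W a b x * pd p b u x) - ?W a b x * pd p b E x * pd p a u x)"
    if ab: "a < p + q" "b < p + q" for a b
  proof -
    have step: "(E y * E y * \<rho> y) * S a b y * pd p b v y =
        E y * (?W a b y * pd p b u y) - (?W a b y * pd p b E y) * u y" if y: "y \<in> V" for y
    proof -
      have pdu: "pd p b u y = pd p b E y * v y + E y * pd p b v y"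
        using pd_mult[OF c1(1,2) y E(2)[OF y], of b] by (simp add: u_def)
      have c: "E y * z = z * E y" for z by (rule even_commute[OF E(2)[OF y]])
      have W: "?W a b y * pd p b E y * u y = E y * (?W a b y * (pd p b E y * v y))"
        unfolding u_def by (simp add: c[of "?W a b y * pd p b E y", symmetric] mult.assoc flip: mult.assoc)
      have "E y * (?W a b y * (E y * pd p b v y)) = E y * E y * \<rho> y * S a b y * pd p b v y"
        using c[of "?W a b y"] by (simp add: mult.assoc)
      then show ?thesis unfolding W pdu by (simp add: distrib_left)
    qed
    have flux: "cdiff 1 (\<lambda>x. ?W a b x * pd p b u x)" "cdiff 1 (\<lambda>x. ?W a b x * pd p b E x)"
      using cdiff_flux[OF \<rho> _ ab, of 1] u E(1) by (simp_all only: two)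
    have par: "has_parity (cpar p a + cpar p b + 1 + cpar p b) (?W a b x * pd p b E x)"
      using has_parity_mult[OF has_parity_mult[OF volume_coeffD(2)[OF \<rho> x] S_parity[OF ab x]]
          has_parity_pd[OF E(2) x, where a = b]] by simp
    \<comment> \<open>The parity of b enters twice, from \<open>S\<close> and from the derivative of
      \<open>E\<close>, which leaves the even exponent a (a + 1).\<close>
    have sign: "(- 1) ^ (cpar p a * (cpar p a + cpar p b + 1 + cpar p b)) = (1 :: real)"
      by (simp add: cpar_def)
    have "pd p a (\<lambda>x. (E x * E x * \<rho> x) * S a b x * pd p b v x) x =
        pd p a (\<lambda>x. E x * (?W a b x * pd p b u x) - (?W a b x * pd p b E x) * u x) x"
      by (rule pd_cong[OF step x])
    also have "\<dots> = pd p a (\<lambda>x. E x * (?W a b x * pd p b u x)) x - pd p a (\<lambda>x. (?W a b x * pd p b E x) * u x) x"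
      by (intro pd_diff cdiff_mult[of 1 E] cdiff_mult[of 1 _ u] flux c1 x)
    also have "pd p a (\<lambda>x. E x * (?W a b x * pd p b u x)) x =
        pd p a E x * (?W a b x * pd p b u x) + E x * pd p a (\<lambda>x. ?W a b x * pd p b u x) x"
      using pd_mult[OF c1(1) flux(1) x E(2)[OF x], of a] by simp
    also have "pd p a (\<lambda>x. (?W a b x * pd p b E x) * u x) x =
        pd p a (\<lambda>x. ?W a b x * pd p b E x) x * u x + ?W a b x * pd p b E x * pd p a u x"
      using pd_mult[OF flux(2) c1(3) x par, of a] by (simp only: sign scaleR_one)
    finally show ?thesis by simp
  qed
  have "has_parity (cpar p a) (pd p a E x)" for a
    using has_parity_pd[OF E(2) x, where a = a] by simp
  \<comment> \<open>With the derivatives of \<open>E\<close> as \<open>e\<close> and those of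
    \<open>u\<close> as \<open>h\<close>, the swap identifies the two halves of the bracket in
    \<open>expand\<close>; \<open>h\<close> may have any parity.\<close>
  from S_contract_swap[OF x volume_coeffD(2)[OF \<rho> x], of "\<lambda>a. pd p a E x", OF this]
  have "(\<Sum>a<p + q. \<Sum>b<p + q. pd p a E x * (?W a b x * pd p b u x) - ?W a b x * pd p b E x * pd p a u x) = 0"
    by (simp add: sum_subtractf)
  then show ?thesis
    unfolding divgrad_def
    by (simp add: expand sum.distrib sum_subtractf sum_distrib_left sum_distrib_right)
qed

text \<open>For even \<open>f\<close> the sum over \<epsilon> reduces to the term \<epsilon> = 0, in
  which the parity sign is 1.\<close>

lemma odd_bracket_even:
  assumes f: "\<And>x. x \<in> V \<Longrightarrow> has_parity 0 (f x)" and x: "x \<in> V"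
  shows "odd_bracket p q S f g x = - (\<Sum>a<p + q. \<Sum>b<p + q. S a b x * pd p b f x * pd p a g x)"
proof -
  have "pd p b (\<lambda>x. gpart 0 (f x)) x = pd p b f x" "pd p b (\<lambda>x. gpart 1 (f x)) x = pd p b (\<lambda>x. 0) x" for b
    by (intro pd_cong x; simp add: gpart_eq[OF f])+
  moreover have "pd p b (\<lambda>x. 0) x = 0" for b
    by (auto simp: pd_def intro!: even_deriv_eqI has_coef_derivative_const)
  ultimately show ?thesis
    by (simp add: odd_bracket_def numeral_2_eq_2 sum_negf)
qed

text \<open>The 2 on the left clears the factor of \<open>d E = (1/2) E d\<sigma>\<close>. The 1/2
  on the right arises when the outer derivative meets \<open>E\<close> again.\<close>

lemma divgrad_exp_half:
  assumes \<rho>: "volume_coeff \<rho>" and \<sigma>: "cdiff 2 \<sigma>" "\<And>x. x \<in> V \<Longrightarrow> has_parity 0 (\<sigma> x)" and x: "x \<in> V"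
  defines "E \<equiv> \<lambda>x. gexp ((1 / 2) *\<^sub>R \<sigma> x)"
  shows "2 *\<^sub>R divgrad \<rho> E x = E x * (divgrad \<rho> \<sigma> x - (1 / 2) *\<^sub>R (\<rho> x * odd_bracket p q S \<sigma> \<sigma> x))"
proof -
  note two = numeral_2_eq_2 One_nat_def
  have \<sigma>1: "cdiff 1 \<sigma>" using cdiff_SucD[of 1] \<sigma>(1) by (simp only: two)
  have half: "has_parity 0 ((1 / 2) *\<^sub>R \<sigma> y)" if "y \<in> V" for y
    by (rule has_parity_scaleR[OF \<sigma>(2)[OF that]])
  have E1: "cdiff 1 E" unfolding E_def
    by (intro cdiff_glift cdiff_scaleR \<sigma>1 half smooth_at_exp)
  have E_even: "has_parity 0 (E y)" if "y \<in> V" for y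
    unfolding E_def by (rule has_parity_glift[OF half[OF that]])
  have pdE: "pd p b E y = (1 / 2) *\<^sub>R (E y * pd p b \<sigma> y)" if "y \<in> V" for b y
    unfolding E_def using pd_glift[OF cdiff_scaleR[OF \<sigma>1] half[OF that] smooth_at_exp that]
    by (simp add: pd_scaleR[OF \<sigma>1 that])
  let ?W = "\<lambda>a b x. \<rho> x * S a b x"
  have expand: "2 *\<^sub>R pd p a (\<lambda>x. ?W a b x * pd p b E x) x =
      E x * (pd p a (\<lambda>x. ?W a b x * pd p b \<sigma> x) x + (1 / 2) *\<^sub>R (pd p a \<sigma> x * (?W a b x * pd p b \<sigma> x)))"
    if ab: "a < p + q" "b < p + q" for a b
  proof -
    have flux: "cdiff 1 (\<lambda>x. ?W a b x * pd p b \<sigma> x)"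
      using cdiff_flux[OF \<rho> _ ab, of 1] \<sigma>(1) by (simp only: two)
    have "pd p a (\<lambda>x. ?W a b x * pd p b E x) x = pd p a (\<lambda>x. (1 / 2) *\<^sub>R (E x * (?W a b x * pd p b \<sigma> x))) x"
    proof (rule pd_cong[OF _ x])
      show "?W a b y * pd p b E y = (1 / 2) *\<^sub>R (E y * (?W a b y * pd p b \<sigma> y))" if "y \<in> V" for y
        using even_commute[OF E_even[OF that], of "?W a b y"] by (simp add: pdE[OF that] flip: mult.assoc)
    qed
    also have "\<dots> = (1 / 2) *\<^sub>R pd p a (\<lambda>x. E x * (?W a b x * pd p b \<sigma> x)) x"
      by (intro pd_scaleR cdiff_mult[of 1 E] E1 flux x)
    also have "pd p a (\<lambda>x. E x * (?W a b x * pd p b \<sigma> x)) x =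
        pd p a E x * (?W a b x * pd p b \<sigma> x) + E x * pd p a (\<lambda>x. ?W a b x * pd p b \<sigma> x) x"
      using pd_mult[OF E1 flux x E_even[OF x], where a = a] by simp
    finally show ?thesis by (simp add: pdE[OF x] mult.assoc distrib_left)
  qed
  have "has_parity (cpar p a) (pd p a \<sigma> x)" for a
    using has_parity_pd[OF \<sigma>(2) x, where a = a] by simp
  from S_contract_swap[OF x volume_coeffD(2)[OF \<rho> x], of "\<lambda>a. pd p a \<sigma> x", OF this]
  \<comment> \<open>The minus sign of the bracket term has its origin here, in the overall sign of
    \<open>odd_bracket\<close>.\<close>
  have contract: "(\<Sum>a<p + q. \<Sum>b<p + q. pd p a \<sigma> x * (?W a b x * pd p b \<sigma> x)) =
      - (\<rho> x * odd_bracket p q S \<sigma> \<sigma> x)"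
    by (simp add: odd_bracket_even[OF \<sigma>(2) x] sum_distrib_left mult.assoc)
  have "2 *\<^sub>R divgrad \<rho> E x = (\<Sum>a<p + q. \<Sum>b<p + q. 2 *\<^sub>R pd p a (\<lambda>x. ?W a b x * pd p b E x) x)"
    by (simp only: divgrad_def scaleR_sum_right)
  also have "\<dots> = (\<Sum>a<p + q. \<Sum>b<p + q. E x * (pd p a (\<lambda>x. ?W a b x * pd p b \<sigma> x) x +
      (1 / 2) *\<^sub>R (pd p a \<sigma> x * (?W a b x * pd p b \<sigma> x))))"
    by (intro sum.cong refl expand) auto
  also have "\<dots> = E x * ((\<Sum>a<p + q. \<Sum>b<p + q. pd p a (\<lambda>x. ?W a b x * pd p b \<sigma> x) x) +
      (1 / 2) *\<^sub>R (\<Sum>a<p + q. \<Sum>b<p + q. pd p a \<sigma> x * (?W a b x * pd p b \<sigma> x)))"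
    by (simp only: sum_distrib_left distrib_left sum.distrib scaleR_sum_right)
  finally show ?thesis by (simp add: contract divgrad_def)
qed

lemma chart_master_function:
  assumes \<rho>: "volume_coeff \<rho>" and \<sigma>: "cdiff 2 \<sigma>" "\<And>x. x \<in> V \<Longrightarrow> has_parity 0 (\<sigma> x)" and x: "x \<in> V"
  shows "2 *\<^sub>R (gexp (- (1 / 2) *\<^sub>R \<sigma> x) * chart_laplace \<rho> (\<lambda>x. gexp ((1 / 2) *\<^sub>R \<sigma> x)) x) =
    chart_laplace \<rho> \<sigma> x - (1 / 2) *\<^sub>R odd_bracket p q S \<sigma> \<sigma> x"
proof -
  let ?E = "\<lambda>x. gexp ((1 / 2) *\<^sub>R \<sigma> x)" and ?e = "gexp (- (1 / 2) *\<^sub>R \<sigma> x)" and ?g = "ginv (\<rho> x)"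
  have "cdiff 2 ?E"
    by (intro cdiff_glift cdiff_scaleR \<sigma> has_parity_scaleR smooth_at_exp)
  then have "2 *\<^sub>R (?e * chart_laplace \<rho> ?E x) = ?e * (?g * (2 *\<^sub>R divgrad \<rho> ?E x))"
    by (simp add: chart_laplace_eq[OF \<rho> _ x])
  also have "\<dots> = ?e * (?g * (?E x * (divgrad \<rho> \<sigma> x - (1 / 2) *\<^sub>R (\<rho> x * odd_bracket p q S \<sigma> \<sigma> x))))"
    by (simp only: divgrad_exp_half[OF \<rho> \<sigma> x])
  also have "\<dots> = (?e * ?E x) * (?g * (divgrad \<rho> \<sigma> x - (1 / 2) *\<^sub>R (\<rho> x * odd_bracket p q S \<sigma> \<sigma> x)))"
  proof -
    have "?g * (?E x * z) = ?E x * (?g * z)" for z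
      using even_commute[of "?E x" ?g] \<sigma>(2)[OF x]
      by (simp add: has_parity_glift has_parity_scaleR flip: mult.assoc)
    then show ?thesis by (simp only: mult.assoc)
  qed
  also have "?e * ?E x = 1" by (rule gexp_minus_mult[OF \<sigma>(2)[OF x]])
  also have "?g * (divgrad \<rho> \<sigma> x - (1 / 2) *\<^sub>R (\<rho> x * odd_bracket p q S \<sigma> \<sigma> x)) =
      ?g * divgrad \<rho> \<sigma> x - (1 / 2) *\<^sub>R ((?g * \<rho> x) * odd_bracket p q S \<sigma> \<sigma> x)"
    by (simp add: right_diff_distrib mult.assoc)
  also have "?g * \<rho> x = 1" by (intro ginv_mult volume_coeffD[OF \<rho>] x)
  finally show ?thesis by (simp add: chart_laplace_eq[OF \<rho> \<sigma>(1) x])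
qed

text \<open>The functions \<open>u\<close> and \<open>v\<close> of the proof represent the same
  half-density relative to \<rho> and \<rho>'. The root of \<rho>' is \<open>E\<close> times the
  root of \<rho>, which gives \<open>u = E v\<close> and reduces the claim to
  \<open>divgrad_conjugate\<close>; what remains is the bookkeeping of even prefactors.\<close>

lemma chart_half_laplace:
  assumes \<rho>: "volume_coeff \<rho>" and \<rho>': "volume_coeff \<rho>'"
    and \<sigma>: "cdiff 2 \<sigma>" "\<And>x. x \<in> V \<Longrightarrow> has_parity 0 (\<sigma> x)"
    and eq: "\<And>x. x \<in> V \<Longrightarrow> \<rho>' x = gexp (\<sigma> x) * \<rho> x" and s: "cdiff 2 s" and x: "x \<in> V"
  shows "gsqrt (\<rho>' x) * chart_laplace \<rho>' (\<lambda>x. s x * ginv (gsqrt (\<rho>' x))) x =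
    gsqrt (\<rho> x) * chart_laplace \<rho> (\<lambda>x. s x * ginv (gsqrt (\<rho> x))) x
    - (gexp (- (1 / 2) *\<^sub>R \<sigma> x) * chart_laplace \<rho> (\<lambda>x. gexp ((1 / 2) *\<^sub>R \<sigma> x)) x) * s x"
proof -
  define E e where "E = (\<lambda>x. gexp ((1 / 2) *\<^sub>R \<sigma> x))" and "e = (\<lambda>x. gexp (- (1 / 2) *\<^sub>R \<sigma> x))"
  define u v where "u = (\<lambda>x. s x * ginv (gsqrt (\<rho> x)))" and "v = (\<lambda>x. s x * ginv (gsqrt (\<rho>' x)))"
  have cdiff_half: "cdiff 2 (\<lambda>x. s x * ginv (gsqrt (\<tau> x)))" if "volume_coeff \<tau>" for \<tau>
    by (intro cdiff_mult cdiff_glift s volume_coeffD[OF that] has_parity_glift smooth_at_sqrt smooth_at_inverse)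
      (simp_all add: volume_coeffD[OF that])
  have uv: "cdiff 2 u" "cdiff 2 v" unfolding u_def v_def by (intro cdiff_half \<rho> \<rho>')+
  have E: "cdiff 2 E" unfolding E_def
    by (intro cdiff_glift cdiff_scaleR \<sigma> has_parity_scaleR smooth_at_exp)
  have even: "has_parity 0 (E y)" "has_parity 0 (e y)" "has_parity 0 (gsqrt (\<rho> y))" if "y \<in> V" for y
    unfolding E_def e_def
    by (intro has_parity_glift has_parity_scaleR \<sigma>(2) volume_coeffD(2)[OF \<rho>] that)+
  have eE: "e y * E y = 1" if "y \<in> V" for y
    unfolding E_def e_def by (rule gexp_minus_mult[OF \<sigma>(2)[OF that]])
  have EE: "gexp (\<sigma> y) = E y * E y" if "y \<in> V" for y
    unfolding E_def using gexp_scaleR_add[OF \<sigma>(2)[OF that], of "1 / 2" "1 / 2"] by simp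
  have sqrt: "gsqrt (\<rho>' y) = E y * gsqrt (\<rho> y)" if "y \<in> V" for y
    using gsqrt_gexp_mult[of "\<sigma> y" "\<rho> y"] that \<sigma>(2) volume_coeffD[OF \<rho>] by (simp add: eq E_def)
  \<comment> \<open>Applied once to the root of \<rho>, and twice to invert \<rho>' = E * (E *
    \<rho>).\<close>
  have ginv_scale: "ginv (E y * w) = e y * ginv w"
    if "y \<in> V" "has_parity 0 w" "0 < gbody w" for y w
  proof (rule ginv_eqI)
    have "e y * ginv w * (E y * w) = e y * (ginv w * E y) * w" by (simp add: mult.assoc)
    also have "ginv w * E y = E y * ginv w" by (rule even_commute) (intro has_parity_glift that)
    also have "e y * (E y * ginv w) * w = (e y * E y) * (ginv w * w)" by (simp add: mult.assoc)
    finally show "e y * ginv w * (E y * w) = 1" by (simp add: eE ginv_mult that)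
    show "has_parity 0 (E y * w)" using has_parity_mult[OF even(1) that(2)] that by simp
    show "0 < gbody (E y * w)" using that by (simp add: E_def)
  qed
  have Ev: "E y * v y = u y" if y: "y \<in> V" for y
  proof -
    have "E y * v y = s y * (E y * e y) * ginv (gsqrt (\<rho> y))"
      using even_commute[OF even(1)[OF y], of "s y"] volume_coeffD(3)[OF \<rho> y] even(3)[OF y]
      by (simp add: v_def sqrt[OF y] ginv_scale[OF y] flip: mult.assoc)
    also have "E y * e y = 1" using even_commute[OF even(1)[OF y]] eE[OF y] by simp
    finally show ?thesis by (simp add: u_def)
  qed
  let ?r = "gsqrt (\<rho> x)" and ?g = "ginv (\<rho> x)" and ?A = "divgrad \<rho> u x" and ?B = "divgrad \<rho> E x"
  have cE: "E x * z = z * E x" and ce: "e x * z = z * e x" and cr: "?r * z = z * ?r" for z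
    by (rule even_commute, rule even[OF x])+
  have "chart_laplace \<rho>' v x = ginv (\<rho>' x) * divgrad (\<lambda>x. E x * E x * \<rho> x) v x"
    unfolding chart_laplace_eq[OF \<rho>' uv(2) x]
    by (simp add: divgrad_cong[of \<rho>' "\<lambda>x. E x * E x * \<rho> x" v v x] eq EE x)
  also have "divgrad (\<lambda>x. E x * E x * \<rho> x) v x = E x * ?A - ?B * u x"
    using divgrad_conjugate[OF \<rho> E even(1) uv(2) x] divgrad_cong[of \<rho> \<rho>, OF refl Ev x] by (simp add: Ev x)
  also have "ginv (\<rho>' x) = e x * (e x * ?g)"
  proof -
    have "has_parity 0 (E x * \<rho> x)" "0 < gbody (E x * \<rho> x)"
      using has_parity_mult[OF even(1)[OF x] volume_coeffD(2)[OF \<rho> x]] volume_coeffD(3)[OF \<rho> x]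
      by (simp_all add: E_def)
    then show ?thesis
      using ginv_scale[OF x, of "E x * \<rho> x"] ginv_scale[OF x, of "\<rho> x"] volume_coeffD[OF \<rho>] x
      by (simp add: eq EE mult.assoc)
  qed
  finally have "gsqrt (\<rho>' x) * chart_laplace \<rho>' v x =
      (E x * ?r * (e x * (e x * ?g))) * (E x * ?A - ?B * u x)"
    by (simp add: sqrt[OF x] mult.assoc)
  \<comment> \<open>The root contributes one \<open>E\<close> and the inverse volume two factors
    \<open>e\<close>. The surviving \<open>e\<close> cancels the \<open>E\<close> in front of
    \<open>?A\<close> and becomes the exponential prefactor of the multiplication term.\<close>
  also have "E x * ?r * (e x * (e x * ?g)) = e x * (?r * ?g)"
  proof -
    have "E x * ?r * (e x * (e x * ?g)) = E x * ((?r * e x) * (e x * ?g))" by (simp add: mult.assoc)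
    also have "?r * e x = e x * ?r" by (rule cr)
    also have "E x * (e x * ?r * (e x * ?g)) = (e x * E x) * ((?r * e x) * ?g)"
      by (simp add: cE[of "e x", symmetric] flip: mult.assoc)
    finally show ?thesis by (simp add: eE x cr[of "e x"] mult.assoc)
  qed
  also have "e x * (?r * ?g) * (E x * ?A - ?B * u x) =
      (e x * E x) * (?r * (?g * ?A)) - (e x * (?g * ?B)) * (?r * u x)"
  proof -
    have "e x * (?r * ?g) * (E x * ?A) = e x * ((?r * ?g) * E x) * ?A" by (simp add: mult.assoc)
    also have "(?r * ?g) * E x = E x * (?r * ?g)" by (rule cE[symmetric])
    finally have 1: "e x * (?r * ?g) * (E x * ?A) = (e x * E x) * (?r * (?g * ?A))"
      by (simp add: mult.assoc)
    have "e x * (?r * ?g) * (?B * u x) = e x * (?r * (?g * ?B)) * u x" by (simp add: mult.assoc)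
    also have "?r * (?g * ?B) = (?g * ?B) * ?r" by (rule cr)
    finally have 2: "e x * (?r * ?g) * (?B * u x) = (e x * (?g * ?B)) * (?r * u x)"
      by (simp add: mult.assoc)
    show ?thesis by (simp add: right_diff_distrib 1 2)
  qed
  also have "?r * u x = s x"
  proof -
    have "?r * u x = s x * (ginv ?r * ?r)" by (simp add: u_def cr mult.assoc)
    then show ?thesis using ginv_mult[OF even(3)[OF x]] volume_coeffD(3)[OF \<rho> x] by simp
  qed
  also have "e x * E x = 1" by (rule eE[OF x])
  finally show ?thesis
    using chart_laplace_eq[OF \<rho> uv(1) x] chart_laplace_eq[OF \<rho> E x]
    by (simp add: u_def v_def E_def e_def)
qed

end

section \<open>From charts to the supermanifold\<close>

lemma oriented_supermanifold_chart:
  assumes "oriented_supermanifold M" "odd_poisson M S" "\<alpha> \<in> sm_charts M"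
  shows "odd_poisson_chart (sm_even M) (sm_img M \<alpha>) (sm_odd M) (S \<alpha>)"
proof
  show "\<forall>\<^sub>F t in nhds (x i). x(i := t) \<in> sm_img M \<alpha>" if "x \<in> sm_img M \<alpha>" "i < sm_even M" for x i
    using eventually_coordinate_line[OF _ that] assms
    by (auto simp: oriented_supermanifold_def supermanifold_def Let_def)
next
  fix a b assume ab: "a < sm_even M + sm_odd M" "b < sm_even M + sm_odd M"
  have S: "superfunction_on (sm_even M) (sm_odd M) (sm_img M \<alpha>) (S \<alpha> a b) \<and>
      (\<forall>x\<in>sm_img M \<alpha>. has_parity (cpar (sm_even M) a + cpar (sm_even M) b + 1) (S \<alpha> a b x) \<and>
        S \<alpha> a b x = (- 1) ^ (cpar (sm_even M) a * cpar (sm_even M) b) * S \<alpha> b a x)"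
    using assms(2,3) ab unfolding odd_poisson_def Let_def by blast
  show "superfunction_on (sm_even M) (sm_odd M) (sm_img M \<alpha>) (S \<alpha> a b)"
    using S by (rule conjunct1)
  fix x assume "x \<in> sm_img M \<alpha>"
  with S show "has_parity (cpar (sm_even M) a + cpar (sm_even M) b + 1) (S \<alpha> a b x)"
    "S \<alpha> a b x = (- 1) ^ (cpar (sm_even M) a * cpar (sm_even M) b) * S \<alpha> b a x"
    by blast+
qed


theorem theorem2p4:
  fixes M :: "('m, 'i) supermfd"
    and S :: "'i \<Rightarrow> nat \<Rightarrow> nat \<Rightarrow> superfun"
    and \<rho> \<rho>' \<sigma> :: "'i local_coeffs"
  assumes "oriented_supermanifold M"
    and "odd_poisson M S"
    and "nondegenerate_volume_form M \<rho>"
    and "nondegenerate_volume_form M \<rho>'"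
    and "even_function M \<sigma>"
    and "sm_eq M \<rho>' (\<lambda>\<alpha> x. gexp (\<sigma> \<alpha> x) * \<rho> \<alpha> x)"
  shows "(\<forall>s. half_density M s \<longrightarrow>
            sm_eq M (half_laplace M S \<rho>' s)
              (\<lambda>\<alpha> x. half_laplace M S \<rho> s \<alpha> x - conj_laplace M S \<rho> \<sigma> \<alpha> x * s \<alpha> x) \<and>
            sm_eq M (half_laplace M S \<rho>' s)
              (\<lambda>\<alpha> x. half_laplace M S \<rho> s \<alpha> x - (1 / 2) *\<^sub>R (master_H M S \<rho>' \<rho> \<alpha> x * s \<alpha> x))) \<and>
         sm_eq M (master_H M S \<rho>' \<rho>)
           (\<lambda>\<alpha> x. odd_laplace M S \<rho> \<sigma> \<alpha> x - (1 / 2) *\<^sub>R mfd_bracket M S \<sigma> \<sigma> \<alpha> x) \<and>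
         sm_eq M (master_H M S \<rho>' \<rho>) (\<lambda>\<alpha> x. 2 *\<^sub>R conj_laplace M S \<rho> \<sigma> \<alpha> x)"
proof -
  \<comment> \<open>\<open>sm_eq\<close> compares coefficients chart by chart, so all identities are
    settled at one point of one chart.\<close>
  have local_master: "master_H M S \<rho>' \<rho> \<alpha> x = odd_laplace M S \<rho> \<sigma> \<alpha> x - (1 / 2) *\<^sub>R mfd_bracket M S \<sigma> \<sigma> \<alpha> x"
      "master_H M S \<rho>' \<rho> \<alpha> x = 2 *\<^sub>R conj_laplace M S \<rho> \<sigma> \<alpha> x"
    and local_half: "half_density M s \<Longrightarrow>
      half_laplace M S \<rho>' s \<alpha> x = half_laplace M S \<rho> s \<alpha> x - conj_laplace M S \<rho> \<sigma> \<alpha> x * s \<alpha> x"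
    if \<alpha>: "\<alpha> \<in> sm_charts M" and x: "x \<in> sm_img M \<alpha>" for s \<alpha> x
  proof -
    interpret odd_poisson_chart "sm_even M" "sm_img M \<alpha>" "sm_odd M" "S \<alpha>"
      by (rule oriented_supermanifold_chart[OF assms(1,2) \<alpha>])
    have density: "cdiff n (f \<alpha>)" if "density_with w M f" for w f n
      using that \<alpha> by (auto simp: density_with_def intro: superfunction_on_cdiff)
    have vol: "volume_coeff (\<rho> \<alpha>)" "volume_coeff (\<rho>' \<alpha>)"
      using assms(3,4) \<alpha> density by (auto simp: nondegenerate_volume_form_def volume_coeff_def)
    have \<sigma>: "cdiff n (\<sigma> \<alpha>)" "y \<in> sm_img M \<alpha> \<Longrightarrow> has_parity 0 (\<sigma> \<alpha> y)" for n y
      using assms(5) \<alpha> density by (auto simp: even_function_def sm_function_def)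
    have eq: "\<rho>' \<alpha> y = gexp (\<sigma> \<alpha> y) * \<rho> \<alpha> y" if "y \<in> sm_img M \<alpha>" for y
      using assms(6) \<alpha> that by (simp add: sm_eq_def)
    have laplace: "odd_laplace M S \<tau> f \<alpha> x = chart_laplace (\<tau> \<alpha>) (f \<alpha>) x" for \<tau> f
      by (simp add: odd_laplace_def chart_laplace_def Let_def)
    \<comment> \<open>The logarithm must be recognised as \<sigma> on the whole chart image, not
      merely at \<open>x\<close>, since \<open>master_H\<close> differentiates it.\<close>
    have \<tau>: "gln (\<rho>' \<alpha> y * ginv (\<rho> \<alpha> y)) = \<sigma> \<alpha> y" if y: "y \<in> sm_img M \<alpha>" for y
    proof -
      have "\<rho> \<alpha> y * ginv (\<rho> \<alpha> y) = 1"
        using even_commute[of "\<rho> \<alpha> y" "ginv (\<rho> \<alpha> y)"] ginv_mult volume_coeffD[OF vol(1)] y by simp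
      then show ?thesis by (simp add: eq y mult.assoc gln_gexp \<sigma>)
    qed
    have "odd_bracket (sm_even M) (sm_odd M) (S \<alpha>) (\<lambda>x. gln (\<rho>' \<alpha> x * ginv (\<rho> \<alpha> x)))
        (\<lambda>x. gln (\<rho>' \<alpha> x * ginv (\<rho> \<alpha> x))) x = mfd_bracket M S \<sigma> \<sigma> \<alpha> x"
      unfolding mfd_bracket_def odd_bracket_def
      by (intro sum.cong refl arg_cong[where f = uminus] arg_cong2[where f = "(*)"] pd_cong x)
        (simp_all add: \<tau>)
    moreover have "chart_laplace (\<rho> \<alpha>) (\<lambda>x. gln (\<rho>' \<alpha> x * ginv (\<rho> \<alpha> x))) x = odd_laplace M S \<rho> \<sigma> \<alpha> x"
      unfolding laplace by (rule chart_laplace_cong[OF vol(1) \<sigma>(1) _ x]) (simp add: \<tau>)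
    ultimately show H: "master_H M S \<rho>' \<rho> \<alpha> x = odd_laplace M S \<rho> \<sigma> \<alpha> x - (1 / 2) *\<^sub>R mfd_bracket M S \<sigma> \<sigma> \<alpha> x"
      by (simp add: master_H_def laplace mfd_bracket_def)
    show "master_H M S \<rho>' \<rho> \<alpha> x = 2 *\<^sub>R conj_laplace M S \<rho> \<sigma> \<alpha> x"
      using chart_master_function[OF vol(1) \<sigma> x] H
      by (simp add: conj_laplace_def laplace mfd_bracket_def)
    show "half_laplace M S \<rho>' s \<alpha> x = half_laplace M S \<rho> s \<alpha> x - conj_laplace M S \<rho> \<sigma> \<alpha> x * s \<alpha> x"
      if "half_density M s"
      using chart_half_laplace[OF vol \<sigma> eq _ x, of "s \<alpha>"] density[OF that[unfolded half_density_def]]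
      by (simp add: half_laplace_def conj_laplace_def laplace)
  qed
  show ?thesis
    unfolding sm_eq_def
    by (intro conjI allI impI ballI local_master local_half)
      (simp_all add: local_half local_master(2))
qed

end
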